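(* There exist infinitely many hyperelliptic curves of genus $3$ over $\mathbb{Q}$ whose Jacobians possess a $\mathbb{Q}$-rational point of order $13$.
   Context: A hyperelliptic curve of genus $g$ over $\mathbb{Q}$ is a smooth projective curve given by $y^2=f(x)$ with $f\in\mathbb{Q}[x]$ squarefree of degree $2g+1$ or $2g+2$; its Jacobian is the Jacobian variety over $\mathbb{Q}$. *)

theory Defs
  imports
    "HOL-Algebra.Algebraic_Closure_Type"
    "HOL-Algebra.Free_Abelian_Groups"
    "HOL-Algebra.Multiplicative_Group"
    "HOL-Computational_Algebra.Squarefree"
begin

definition hyperelliptic_poly :: "nat \<Rightarrow> rat poly \<Rightarrow> bool" where
  "hyperelliptic_poly g f \<longleftrightarrow> squarefree f \<and> (degree f = 2 * g + 1 \<or> degree f = 2 * g + 2)"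

text \<open>
  The smooth projective curve \<open>y\<^sup>2 = f(x)\<close> over \<open>k\<close> is represented by its function field
  \<open>k(x)[y]/(y\<^sup>2 - f)\<close>, realised inside a fixed algebraic closure of \<open>k(x)\<close>.
  Smooth projective curves over \<open>k\<close> and their function fields determine each other, and
  isomorphisms of curves over \<open>k\<close> are the isomorphisms of function fields over \<open>k\<close>.
\<close>

definition fun_of_poly :: "'k::field poly \<Rightarrow> 'k poly fract alg_closure" where
  "fun_of_poly p = to_ac (Fraction_Field.Fract p 1)"

definition fun_const :: "'k::field \<Rightarrow> 'k poly fract alg_closure" where
  "fun_const c = fun_of_poly [:c:]"

definition fun_y :: "'k::field poly \<Rightarrow> 'k poly fract alg_closure" where
  "fun_y f = (SOME y. y\<^sup>2 = fun_of_poly f)"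

definition function_field :: "'k::field poly \<Rightarrow> 'k poly fract alg_closure set" where
  "function_field f = {to_ac r + to_ac s * fun_y f | r s. True}"

definition curve_isomorphic :: "'k::field poly \<Rightarrow> 'k poly \<Rightarrow> bool" where
  "curve_isomorphic f h \<longleftrightarrow>
     (\<exists>\<phi>. bij_betw \<phi> (function_field f) (function_field h) \<and>
          (\<forall>u\<in>function_field f. \<forall>w\<in>function_field f.
             \<phi> (u + w) = \<phi> u + \<phi> w \<and> \<phi> (u * w) = \<phi> u * \<phi> w) \<and>
          (\<forall>c. \<phi> (fun_const c) = fun_const c))"

text \<open>
  A closed point of the smooth projective curve is given by its order-of-vanishing function: the
  closed points correspond to the normalised discrete valuations of the function field that are
  trivial on constants. This covers the points at infinity as well. The value \<open>0\<close> outside the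
  function field and at the zero function is a convention, making valuations equal as HOL
  functions iff they agree on nonzero functions.
\<close>

type_synonym 'k place = "'k poly fract alg_closure \<Rightarrow> int"

definition curve_points :: "'k::field poly \<Rightarrow> 'k place set" where
  "curve_points f = {v.
     (\<forall>z. z \<notin> function_field f - {0} \<longrightarrow> v z = 0) \<and>
     (\<forall>z\<in>function_field f - {0}. \<forall>w\<in>function_field f - {0}.
        v (z * w) = v z + v w \<and> (z + w \<noteq> 0 \<longrightarrow> min (v z) (v w) \<le> v (z + w))) \<and>
     (\<forall>c. c \<noteq> 0 \<longrightarrow> v (fun_const c) = 0) \<and>
     (\<exists>z\<in>function_field f - {0}. v z = 1)}"

type_synonym 'k divisor = "'k place \<Rightarrow>\<^sub>0 int"

text \<open>
  Divisors are used over an algebraically closed constant field only, where every closed point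
  has degree one.
\<close>

definition divisor_degree :: "'k::field divisor \<Rightarrow> int" where
  "divisor_degree D = (\<Sum>P\<in>Poly_Mapping.keys D. Poly_Mapping.lookup D P)"

definition div0_group :: "'k::field poly \<Rightarrow> 'k divisor monoid" where
  "div0_group f = (free_Abelian_group (curve_points f))
     \<lparr>carrier := {D \<in> carrier (free_Abelian_group (curve_points f)). divisor_degree D = 0}\<rparr>"

definition principal_divisors :: "'k::field poly \<Rightarrow> 'k divisor set" where
  "principal_divisors f = {D \<in> carrier (div0_group f).
     \<exists>z\<in>function_field f - {0}. \<forall>P\<in>curve_points f. Poly_Mapping.lookup D P = P z}"

definition pic0 :: "'k::field poly \<Rightarrow> 'k divisor set monoid" where
  "pic0 f = div0_group f Mod principal_divisors f"

text \<open>
  \<open>Gal(\<rat>\<^sup>a\<^sup>l\<^sup>g/\<rat>)\<close> and its action on the curve \<open>y\<^sup>2 = f(x)\<close> with \<open>f\<close> rational, base-changed to the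
  algebraic closure: on functions it acts on coefficients and fixes \<open>x\<close> and \<open>y\<close>.
\<close>

definition abs_galois :: "(rat alg_closure \<Rightarrow> rat alg_closure) set" where
  "abs_galois = {\<sigma>. bij \<sigma> \<and> (\<forall>a b. \<sigma> (a + b) = \<sigma> a + \<sigma> b \<and> \<sigma> (a * b) = \<sigma> a * \<sigma> b) \<and>
                     (\<forall>q. \<sigma> (to_ac q) = to_ac q)}"

definition base_change :: "rat poly \<Rightarrow> rat alg_closure poly" where
  "base_change f = map_poly to_ac f"

definition galois_fun ::
  "rat poly \<Rightarrow> (rat alg_closure \<Rightarrow> rat alg_closure) \<Rightarrow>
   rat alg_closure poly fract alg_closure \<Rightarrow> rat alg_closure poly fract alg_closure" where
  "galois_fun f \<sigma> z = (THE w. \<exists>a b c. c \<noteq> 0 \<and>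
     z = (fun_of_poly a + fun_of_poly b * fun_y (base_change f)) / fun_of_poly c \<and>
     w = (fun_of_poly (map_poly \<sigma> a) + fun_of_poly (map_poly \<sigma> b) * fun_y (base_change f))
           / fun_of_poly (map_poly \<sigma> c))"

definition galois_point ::
  "rat poly \<Rightarrow> (rat alg_closure \<Rightarrow> rat alg_closure) \<Rightarrow> rat alg_closure place \<Rightarrow>
   rat alg_closure place" where
  "galois_point f \<sigma> v = (\<lambda>z. if z \<in> function_field (base_change f)
                              then v (galois_fun f (inv_into UNIV \<sigma>) z) else 0)"

definition galois_divisor ::
  "rat poly \<Rightarrow> (rat alg_closure \<Rightarrow> rat alg_closure) \<Rightarrow> rat alg_closure divisor \<Rightarrow>
   rat alg_closure divisor" where
  "galois_divisor f \<sigma> = frag_extend (\<lambda>P. frag_of (galois_point f \<sigma> P))"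

text \<open>
  The Jacobian \<open>J\<close> of \<open>C\<close> satisfies \<open>J(\<rat>\<^sup>a\<^sup>l\<^sup>g) = Pic\<^sup>0\<close> of the base-changed curve, Galois-equivariantly,
  so \<open>J(\<rat>)\<close> is the group of Galois-invariant divisor classes of degree zero. (A class may be
  invariant without containing an invariant divisor if \<open>C\<close> has no rational point.)
\<close>

definition jacobian_rational_points :: "rat poly \<Rightarrow> rat alg_closure divisor set monoid" where
  "jacobian_rational_points f = (pic0 (base_change f))
     \<lparr>carrier := {A \<in> carrier (pic0 (base_change f)). \<forall>\<sigma>\<in>abs_galois. galois_divisor f \<sigma> ` A = A}\<rparr>"

end

(*
  Put A = 1 - 26t + 286t^2 - 1716t^3 + 6006t^4 - 12012t^5 + ct^6, whose terms below t^6 are the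
  Taylor polynomial of (1 - 4t)^(13/2). Then A^2 - (1 - 4t)^13 = t^6 f with f of degree 7, and on
  y^2 = f(t) the function A + t^3 y has norm (1 - 4t)^13, hence divisor 13(P - infinity) with P
  rational above t = 1/4. The class of P - infinity is nonzero, because a function with no pole
  besides infinity is a polynomial a + by, whose pole order 2 deg a or 7 + 2 deg b is never 1.

  If y^2 = f(x) and y^2 = h(x) are isomorphic, let u be the image of x. Both x over Q(u) and u over
  Q(x) have degree at most 2, so if u were not in Q(x) its primitive equation over Q[x] would have
  degree at most 2 in x as well, and its discriminant, of degree at most 4, would be h times a
  square. Hence u lies in Q(x); the same argument shows that u is a Moebius transform of x. The
  quadratic invariant of binary octics then changes by a fourth power only. For c = 1/p with p a
  prime it has p-adic valuation -3, so each isomorphism class contains only finitely many of these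
  curves.
*)

theory Submission
  imports
    Defs
    "HOL-Computational_Algebra.Formal_Laurent_Series"
    "HOL-Computational_Algebra.Polynomial_FPS"
begin


text \<open>Degrees dictate the shape. For \<open>A + t^3 y\<close> to have one zero of order 13 and
  no other, its norm \<open>A^2 - t^6 f\<close> must be a constant times the 13th power of a linear
  polynomial; dividing by \<open>t^6\<close> leaves \<open>f\<close> of degree 13 - 6 = 7, that is
  genus 3. Divisibility by \<open>t^6\<close> and \<open>A(0) = 1\<close> determine \<open>A\<close>
  below \<open>t^6\<close>, so \<open>c\<close> is the only freedom; the 4 makes the coefficients
  integers. The choice \<open>c = 1/p\<close> serves twice: it excludes double roots of
  \<open>f\<close> by a sign, and it gives the invariant a pole of order 3 at \<open>p\<close>,
  where 3 is not a multiple of 4, while the invariant of a fixed curve has valuation 0 at almost all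
  primes. Simple roots matter for the torsion as well as for the genus: only then is a function
  without poles outside infinity a polynomial in \<open>x\<close> and \<open>y\<close>. Since 13 is
  prime, a nonzero class killed by 13 has order 13. An isomorphism need not respect the points at
  infinity, so polynomials of degree 7 are compared as octics. Each place used is constructed by a
  Laurent series parametrisation; its uniqueness comes from expressing its values through norms, and
  uniqueness makes rational points Galois-fixed.\<close>

section \<open>Function fields\<close>

lemma fun_of_poly_0 [simp]: "fun_of_poly 0 = 0"
  by (simp add: fun_of_poly_def flip: Zero_fract_def)

lemma fun_of_poly_1 [simp]: "fun_of_poly 1 = 1"
  by (simp add: fun_of_poly_def flip: One_fract_def)

lemma fun_of_poly_add [simp]: "fun_of_poly (p + q) = fun_of_poly p + fun_of_poly q"
  by (simp add: fun_of_poly_def flip: to_ac_add)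

lemma fun_of_poly_mult [simp]: "fun_of_poly (p * q) = fun_of_poly p * fun_of_poly q"
  by (simp add: fun_of_poly_def flip: to_ac_mult)

lemma fun_of_poly_minus [simp]: "fun_of_poly (- p) = - fun_of_poly p"
  by (simp add: fun_of_poly_def flip: to_ac_minus)

lemma fun_of_poly_diff [simp]: "fun_of_poly (p - q) = fun_of_poly p - fun_of_poly q"
  by (simp add: fun_of_poly_def flip: to_ac_diff)

lemma fun_of_poly_power [simp]: "fun_of_poly (p ^ n) = fun_of_poly p ^ n"
  by (induction n) auto

lemma fun_of_poly_eq_iff [simp]: "fun_of_poly p = fun_of_poly q \<longleftrightarrow> p = q"
  by (simp add: fun_of_poly_def eq_fract)

lemma fun_of_poly_eq_0_iff [simp]: "fun_of_poly p = 0 \<longleftrightarrow> p = 0"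
  using fun_of_poly_eq_iff[of p 0] by (simp del: fun_of_poly_eq_iff)

lemma fun_y_square: "(fun_y f)\<^sup>2 = fun_of_poly f"
  unfolding fun_y_def by (rule someI_ex) (rule nth_root_exists, simp)

text \<open>A common polynomial denominator is the form in which values at places are computed and
  in which \<open>galois_fun\<close> is stated.\<close>

lemma function_field_iff:
  "z \<in> function_field f \<longleftrightarrow>
     (\<exists>a b c. c \<noteq> 0 \<and> z = (fun_of_poly a + fun_of_poly b * fun_y f) / fun_of_poly c)"
proof
  assume "z \<in> function_field f"
  then obtain r s where z: "z = to_ac r + to_ac s * fun_y f"
    by (auto simp: function_field_def)
  obtain a c where r: "r = Fract a c" "c \<noteq> 0" by (cases r)
  obtain b d where s: "s = Fract b d" "d \<noteq> 0" by (cases s)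
  have frac: "to_ac (Fract a c) = fun_of_poly a / fun_of_poly c" if "c \<noteq> 0" for a c :: "'a poly"
    using that by (simp add: fun_of_poly_def flip: to_ac_divide)
  have "z = (fun_of_poly (a * d) + fun_of_poly (b * c) * fun_y f) / fun_of_poly (c * d)"
    by (simp only: z r(1) s(1) frac[OF r(2)] frac[OF s(2)] fun_of_poly_mult)
      (use r(2) s(2) in \<open>simp add: field_simps\<close>)
  with r s show "\<exists>a b c. c \<noteq> 0 \<and> z = (fun_of_poly a + fun_of_poly b * fun_y f) / fun_of_poly c"
    by (metis mult_eq_0_iff)
next
  assume "\<exists>a b c. c \<noteq> 0 \<and> z = (fun_of_poly a + fun_of_poly b * fun_y f) / fun_of_poly c"
  then obtain a b c where c: "c \<noteq> 0"
    and z: "z = (fun_of_poly a + fun_of_poly b * fun_y f) / fun_of_poly c" by blast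
  have frac: "fun_of_poly a / fun_of_poly c = to_ac (Fract a c)" for a :: "'a poly"
    using c by (simp add: fun_of_poly_def flip: to_ac_divide)
  have "z = to_ac (Fract a c) + to_ac (Fract b c) * fun_y f"
    by (simp add: z add_divide_distrib flip: frac)
  then show "z \<in> function_field f" by (auto simp: function_field_def)
qed

lemma function_fieldI [intro]:
  "c \<noteq> 0 \<Longrightarrow> (fun_of_poly a + fun_of_poly b * fun_y f) / fun_of_poly c \<in> function_field f"
  by (auto simp: function_field_iff)

lemma function_fieldE [elim?]:
  assumes "z \<in> function_field f"
  obtains a b c where "c \<noteq> 0" "z = (fun_of_poly a + fun_of_poly b * fun_y f) / fun_of_poly c"
  using assms by (auto simp: function_field_iff)

lemma fun_of_poly_in_function_field [simp]: "fun_of_poly p \<in> function_field f"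
  using function_fieldI[of 1 p 0 f] by simp

lemma zero_in_function_field [simp]: "0 \<in> function_field f"
  using fun_of_poly_in_function_field[of 0 f] by simp

lemma one_in_function_field [simp]: "1 \<in> function_field f"
  using fun_of_poly_in_function_field[of 1 f] by simp

lemma fun_y_in_function_field [simp]: "fun_y f \<in> function_field f"
  using function_fieldI[of 1 0 1 f] by simp

lemma function_field_add [simp]:
  assumes "z \<in> function_field f" "w \<in> function_field f" shows "z + w \<in> function_field f"
proof -
  obtain r s r' s' where "z = to_ac r + to_ac s * fun_y f" "w = to_ac r' + to_ac s' * fun_y f"
    using assms by (auto simp: function_field_def)
  then have "z + w = to_ac (r + r') + to_ac (s + s') * fun_y f" by (simp add: algebra_simps)
  then show ?thesis unfolding function_field_def by blast
qed

lemma add_quadratic_fractions: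
  fixes a :: "'a::field"
  assumes "c \<noteq> 0" "c' \<noteq> 0"
  shows "(a + b * y) / c + (a' + b' * y) / c' = ((a * c' + a' * c) + (b * c' + b' * c) * y) / (c * c')"
  using assms by (simp add: field_simps)

lemma mult_quadratic_fractions:
  fixes a :: "'a::field"
  shows "((a + b * y) / c) * ((a' + b' * y) / c')
           = ((a * a' + b * b' * y\<^sup>2) + (a * b' + b * a') * y) / (c * c')"
  by (simp add: algebra_simps power2_eq_square)

lemma mult_fun_y_eq:
  "(a + b * fun_y f) * (a' + b' * fun_y f)
     = (a * a' + b * b' * fun_of_poly f) + (a * b' + b * a') * fun_y f"
  by (simp add: algebra_simps power2_eq_square flip: fun_y_square[of f])

lemma function_field_mult [simp]:
  assumes "z \<in> function_field f" "w \<in> function_field f" shows "z * w \<in> function_field f"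
proof -
  obtain r s r' s' where "z = to_ac r + to_ac s * fun_y f" "w = to_ac r' + to_ac s' * fun_y f"
    using assms by (auto simp: function_field_def)
  then have "z * w = to_ac (r * r' + s * s' * Fract f 1) + to_ac (r * s' + s * r') * fun_y f"
    by (simp add: mult_fun_y_eq fun_of_poly_def)
  then show ?thesis unfolding function_field_def by blast
qed

lemma function_field_uminus [simp]:
  assumes "z \<in> function_field f" shows "- z \<in> function_field f"
  using function_field_mult[OF fun_of_poly_in_function_field[of "-1"] assms] by simp

lemma function_field_diff [simp]:
  assumes "z \<in> function_field f" "w \<in> function_field f" shows "z - w \<in> function_field f"
  using function_field_add[OF assms(1) function_field_uminus[OF assms(2)]] by simp

lemma function_field_power [simp]:
  "z \<in> function_field f \<Longrightarrow> z ^ n \<in> function_field f"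
  by (induction n) auto

section \<open>Odd degree: the norm form and the independence of 1 and y\<close>

locale odd_hyperelliptic =
  fixes f :: "'k::field poly"
  assumes odd_degree: "odd (degree f)"
begin

lemma f_nonzero: "f \<noteq> 0"
  using odd_degree by auto

text \<open>If both terms are nonzero, \<open>a\<^sup>2\<close> has even degree and
  \<open>f * b\<^sup>2\<close> has odd degree, so they cannot cancel. Multiplying by the conjugate
  then gives the independence of 1 and \<open>y\<close>, and inverses.\<close>

lemma norm_nonzero:
  assumes "a \<noteq> 0 \<or> b \<noteq> 0"
  shows "a\<^sup>2 - f * b\<^sup>2 \<noteq> 0"
proof
  assume eq: "a\<^sup>2 - f * b\<^sup>2 = 0"
  show False
  proof (cases "b = 0")
    case True
    with eq assms show False by simp
  next
    case False
    have "degree (a\<^sup>2) = degree (f * b\<^sup>2)" using eq by simp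
    then have "2 * degree a = degree f + 2 * degree b"
      using False f_nonzero by (simp add: degree_mult_eq degree_power_eq power2_eq_square)
        (metis False mult_eq_0_iff degree_mult_eq eq eq_iff_diff_eq_0 f_nonzero mult_2 power2_eq_square)
    then show False using odd_degree by presburger
  qed
qed

lemma independent_iff:
  "fun_of_poly a + fun_of_poly b * fun_y f = 0 \<longleftrightarrow> a = 0 \<and> b = 0"
proof
  assume eq: "fun_of_poly a + fun_of_poly b * fun_y f = 0"
  have "fun_of_poly (a\<^sup>2 - f * b\<^sup>2) = (fun_of_poly a + fun_of_poly b * fun_y f) * (fun_of_poly a - fun_of_poly b * fun_y f)"
    by (simp add: algebra_simps power2_eq_square flip: fun_y_square[of f])
  then have "a\<^sup>2 - f * b\<^sup>2 = 0" using eq by (simp del: fun_of_poly_diff)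
  then show "a = 0 \<and> b = 0" using norm_nonzero by blast
qed auto

lemma function_field_inverse [simp]:
  assumes "z \<in> function_field f" shows "inverse z \<in> function_field f"
proof -
  obtain a b c where c: "c \<noteq> 0" and z: "z = (fun_of_poly a + fun_of_poly b * fun_y f) / fun_of_poly c"
    using assms by (rule function_fieldE)
  show ?thesis
  proof (cases "a = 0 \<and> b = 0")
    case True
    then show ?thesis by (simp add: z)
  next
    case False
    then have n: "a\<^sup>2 - f * b\<^sup>2 \<noteq> 0" using norm_nonzero by blast
    define u where "u = fun_of_poly a + fun_of_poly b * fun_y f"
    define w where "w = fun_of_poly a - fun_of_poly b * fun_y f"
    define N where "N = fun_of_poly (a\<^sup>2 - f * b\<^sup>2)"
    have "N = u * w"
      unfolding N_def u_def w_def
      by (simp add: algebra_simps power2_eq_square flip: fun_y_square[of f])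
    moreover have "N \<noteq> 0" using n unfolding N_def fun_of_poly_eq_0_iff .
    ultimately have "inverse (u / fun_of_poly c) = fun_of_poly c * w / N"
      by simp
    then have "inverse z = (fun_of_poly (c * a) + fun_of_poly (- c * b) * fun_y f) / fun_of_poly (a\<^sup>2 - f * b\<^sup>2)"
      unfolding z u_def[symmetric] N_def[symmetric] by (simp add: w_def algebra_simps)
    then show ?thesis by (simp only: function_fieldI[OF n])
  qed
qed

lemma function_field_divide [simp]:
  assumes "z \<in> function_field f" "w \<in> function_field f" shows "z / w \<in> function_field f"
  using function_field_mult[OF assms(1) function_field_inverse[OF assms(2)]] by (simp add: divide_inverse)

end

section \<open>Extending homomorphisms from polynomials to the function field\<close>

locale curve_hom = odd_hyperelliptic f for f :: "'k::field poly" +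
  fixes \<psi> :: "'k poly \<Rightarrow> 'l::field" and Y :: 'l
  assumes hom_add: "\<psi> (p + q) = \<psi> p + \<psi> q"
    and hom_mult: "\<psi> (p * q) = \<psi> p * \<psi> q"
    and hom_inj: "\<psi> p = 0 \<Longrightarrow> p = 0"
    and hom_Y: "Y\<^sup>2 = \<psi> f"
begin

lemma hom_0: "\<psi> 0 = 0"
  using hom_add[of 0 0] by (metis add_0 add_cancel_right_right)

lemma hom_1: "\<psi> 1 = 1"
  using hom_mult[of 1 1] hom_inj[of 1] by auto

lemma hom_eq_0_iff: "\<psi> p = 0 \<longleftrightarrow> p = 0"
  using hom_0 hom_inj by auto

text \<open>Two targets occur: Laurent series, where the order of vanishing gives a place, and the
  function field itself, where a Galois automorphism acts on coefficients. The latter moves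
  constants, so \<open>\<psi>\<close> is not asked to fix them. The body copies the shape of
  \<open>galois_fun\<close>, so that the two definitions match literally.\<close>

definition ext :: "'k poly fract alg_closure \<Rightarrow> 'l" where
  "ext z = (THE w. \<exists>a b c. c \<noteq> 0 \<and>
     z = (fun_of_poly a + fun_of_poly b * fun_y f) / fun_of_poly c \<and>
     w = (\<psi> a + \<psi> b * Y) / \<psi> c)"

text \<open>Independence of 1 and \<open>y\<close> turns equality of two fractions into two
  polynomial identities, which \<open>\<psi>\<close> respects; so the value does not depend on the
  representation.\<close>

lemma ext_eq:
  assumes c: "c \<noteq> 0"
  shows "ext ((fun_of_poly a + fun_of_poly b * fun_y f) / fun_of_poly c) = (\<psi> a + \<psi> b * Y) / \<psi> c"
  unfolding ext_def
proof (rule the_equality)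
  fix w
  assume "\<exists>a' b' c'. c' \<noteq> 0 \<and>
     (fun_of_poly a + fun_of_poly b * fun_y f) / fun_of_poly c
       = (fun_of_poly a' + fun_of_poly b' * fun_y f) / fun_of_poly c' \<and>
     w = (\<psi> a' + \<psi> b' * Y) / \<psi> c'"
  then obtain a' b' c' where c': "c' \<noteq> 0"
    and eq: "(fun_of_poly a + fun_of_poly b * fun_y f) / fun_of_poly c
       = (fun_of_poly a' + fun_of_poly b' * fun_y f) / fun_of_poly c'"
    and w: "w = (\<psi> a' + \<psi> b' * Y) / \<psi> c'" by blast
  have "fun_of_poly (a * c' - a' * c) + fun_of_poly (b * c' - b' * c) * fun_y f = 0"
    using eq c c' by (simp add: divide_simps) (simp add: algebra_simps)
  then have "a * c' = a' * c" "b * c' = b' * c" by (simp_all only: independent_iff) auto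
  then have "\<psi> a * \<psi> c' = \<psi> a' * \<psi> c" "\<psi> b * \<psi> c' = \<psi> b' * \<psi> c" by (metis hom_mult)+
  then have "(\<psi> a * \<psi> c') + (\<psi> b * \<psi> c') * Y = (\<psi> a' * \<psi> c) + (\<psi> b' * \<psi> c) * Y"
    by (simp only:)
  then have "\<psi> c * (\<psi> a' + \<psi> b' * Y) = \<psi> c' * (\<psi> a + \<psi> b * Y)"
    by (simp only: algebra_simps)
  then show "w = (\<psi> a + \<psi> b * Y) / \<psi> c"
    using c c' by (simp add: w frac_eq_eq hom_eq_0_iff mult.commute)
qed (use c in blast)

lemma ext_add:
  assumes "z \<in> function_field f" "w \<in> function_field f"
  shows "ext (z + w) = ext z + ext w"
proof -
  obtain a b c where c: "c \<noteq> 0" and z: "z = (fun_of_poly a + fun_of_poly b * fun_y f) / fun_of_poly c"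
    using assms(1) by (rule function_fieldE)
  obtain a' b' c' where c': "c' \<noteq> 0" and w: "w = (fun_of_poly a' + fun_of_poly b' * fun_y f) / fun_of_poly c'"
    using assms(2) by (rule function_fieldE)
  have "z + w = (fun_of_poly (a * c' + a' * c) + fun_of_poly (b * c' + b' * c) * fun_y f) / fun_of_poly (c * c')"
    using c c' by (simp only: z w add_quadratic_fractions fun_of_poly_eq_0_iff not_False_eq_True
        fun_of_poly_mult fun_of_poly_add)
  then have "ext (z + w) = (\<psi> (a * c' + a' * c) + \<psi> (b * c' + b' * c) * Y) / \<psi> (c * c')"
    using ext_eq[of "c * c'"] c c' by (simp only: mult_eq_0_iff not_False_eq_True simp_thms)
  also have "\<dots> = (\<psi> a + \<psi> b * Y) / \<psi> c + (\<psi> a' + \<psi> b' * Y) / \<psi> c'"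
    using c c' by (simp only: hom_add hom_mult hom_eq_0_iff add_quadratic_fractions not_False_eq_True)
  finally show ?thesis using ext_eq c c' by (simp add: z w)
qed

lemma ext_mult:
  assumes "z \<in> function_field f" "w \<in> function_field f"
  shows "ext (z * w) = ext z * ext w"
proof -
  obtain a b c where c: "c \<noteq> 0" and z: "z = (fun_of_poly a + fun_of_poly b * fun_y f) / fun_of_poly c"
    using assms(1) by (rule function_fieldE)
  obtain a' b' c' where c': "c' \<noteq> 0" and w: "w = (fun_of_poly a' + fun_of_poly b' * fun_y f) / fun_of_poly c'"
    using assms(2) by (rule function_fieldE)
  have "z * w = (fun_of_poly (a * a' + b * b' * f) + fun_of_poly (a * b' + b * a') * fun_y f) / fun_of_poly (c * c')"
    by (simp only: z w mult_quadratic_fractions fun_y_square fun_of_poly_mult fun_of_poly_add)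
  then have "ext (z * w) = (\<psi> (a * a' + b * b' * f) + \<psi> (a * b' + b * a') * Y) / \<psi> (c * c')"
    using ext_eq[of "c * c'"] c c' by (simp only: mult_eq_0_iff not_False_eq_True simp_thms)
  also have "\<dots> = ((\<psi> a + \<psi> b * Y) / \<psi> c) * ((\<psi> a' + \<psi> b' * Y) / \<psi> c')"
    by (simp only: hom_add hom_mult mult_quadratic_fractions hom_Y)
  finally show ?thesis using ext_eq c c' by (simp add: z w)
qed

lemma ext_fun_of_poly [simp]: "ext (fun_of_poly p) = \<psi> p"
  using ext_eq[of 1 p 0] by (simp add: hom_0 hom_1)

lemma ext_fun_y [simp]: "ext (fun_y f) = Y"
  using ext_eq[of 1 0 1] by (simp add: hom_0 hom_1)

lemma ext_nonzero:
  assumes "z \<in> function_field f" "z \<noteq> 0"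
  shows "ext z \<noteq> 0"
proof
  assume 0: "ext z = 0"
  have "ext (z * inverse z) = ext z * ext (inverse z)"
    using assms by (intro ext_mult) auto
  then have "ext 1 = 0" using 0 assms(2) by simp
  then show False using ext_fun_of_poly[of 1] by (simp add: hom_1 del: ext_fun_of_poly)
qed

end

text \<open>A point of the curve over the field of Laurent series is a parametrisation of the curve near
  a place.\<close>

lemma (in odd_hyperelliptic) place_of_series:
  fixes \<psi> :: "'k poly \<Rightarrow> 'k fls"
  assumes "curve_hom f \<psi> Y"
    and const: "\<And>c. \<psi> [:c:] = fls_const c"
    and unif: "z\<^sub>1 \<in> function_field f" "fls_subdegree (curve_hom.ext f \<psi> Y z\<^sub>1) = 1"
  defines "v \<equiv> \<lambda>z. if z \<in> function_field f then fls_subdegree (curve_hom.ext f \<psi> Y z) else 0"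
  shows "v \<in> curve_points f"
proof -
  interpret curve_hom f \<psi> Y by fact
  have "z\<^sub>1 \<noteq> 0" using unif ext_fun_of_poly[of 0] by (auto simp: hom_0 simp del: ext_fun_of_poly)
  moreover have "v (z * w) = v z + v w" "z + w \<noteq> 0 \<Longrightarrow> min (v z) (v w) \<le> v (z + w)"
    if "z \<in> function_field f - {0}" "w \<in> function_field f - {0}" for z w
    using that ext_nonzero[of "z + w"] fls_plus_subdegree[of "ext z" "ext w"]
    by (auto simp: v_def ext_mult ext_add ext_nonzero)
  moreover have "v z = 0" if "z \<notin> function_field f - {0}" for z
    using that ext_fun_of_poly[of 0] by (auto simp: v_def hom_0 simp del: ext_fun_of_poly)
  moreover have "v (fun_const c) = 0" for c
    by (simp add: v_def fun_const_def const)
  moreover have "v z\<^sub>1 = 1" using unif by (simp add: v_def)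
  ultimately show ?thesis
    using unif unfolding curve_points_def by (intro CollectI conjI) (blast | simp)+
qed

section \<open>Places\<close>

locale place = odd_hyperelliptic f for f :: "'k::field poly" +
  fixes v :: "'k place"
  assumes place: "v \<in> curve_points f"
begin

abbreviation "K \<equiv> function_field f"

text \<open>Since \<open>v 0\<close> is 0 by convention, the bare inequality
  \<open>n \<le> v z\<close> is not closed under addition; here zero counts as having infinite
  value.\<close>

definition at_least :: "int \<Rightarrow> 'k poly fract alg_closure \<Rightarrow> bool" where
  "at_least n z \<longleftrightarrow> z \<in> K \<and> (z = 0 \<or> n \<le> v z)"

lemma v_mult: "z \<in> K \<Longrightarrow> w \<in> K \<Longrightarrow> z \<noteq> 0 \<Longrightarrow> w \<noteq> 0 \<Longrightarrow> v (z * w) = v z + v w"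
  using place unfolding curve_points_def by blast

lemma v_add: "z \<in> K \<Longrightarrow> w \<in> K \<Longrightarrow> z \<noteq> 0 \<Longrightarrow> w \<noteq> 0 \<Longrightarrow> z + w \<noteq> 0 \<Longrightarrow> min (v z) (v w) \<le> v (z + w)"
  using place unfolding curve_points_def by blast

lemma v_const: "c \<noteq> 0 \<Longrightarrow> v (fun_of_poly [:c:]) = 0"
  using place unfolding curve_points_def fun_const_def by blast

lemma v_outside: "z \<notin> K \<or> z = 0 \<Longrightarrow> v z = 0"
  using place unfolding curve_points_def by blast

lemma uniformiser:
  obtains z where "z \<in> K" "z \<noteq> 0" "v z = 1"
  using place unfolding curve_points_def by blast

lemma v_1: "v 1 = 0"
  using v_const[of 1] by (simp flip: one_pCons)

lemma v_uminus: "z \<in> K \<Longrightarrow> v (- z) = v z"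
proof (cases "z = 0")
  case False
  assume "z \<in> K"
  moreover have "fun_of_poly [:- 1:] = (-1 :: 'k poly fract alg_closure)"
    using fun_of_poly_minus[of "[:1:] :: 'k poly"] fun_of_poly_1[where ?'a='k] by (simp add: one_pCons del: fun_of_poly_1)
  ultimately show ?thesis
    using v_mult[of "fun_of_poly [:- 1:]" z] v_const[of "- 1"] False by simp
qed simp

lemma v_power: "z \<in> K \<Longrightarrow> z \<noteq> 0 \<Longrightarrow> v (z ^ n) = int n * v z"
  by (induction n) (auto simp: v_1 v_mult algebra_simps)

lemma v_divide:
  assumes "z \<in> K" "w \<in> K" "z \<noteq> 0" "w \<noteq> 0" shows "v (z / w) = v z - v w"
  using v_mult[of "z / w" w] assms by simp

lemma at_least_add: "at_least n z \<Longrightarrow> at_least n w \<Longrightarrow> at_least n (z + w)"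
  using v_add[of z w] by (cases "z = 0"; cases "w = 0"; cases "z + w = 0") (auto simp: at_least_def)

lemma at_least_uminus: "at_least n z \<Longrightarrow> at_least n (- z)"
  by (auto simp: at_least_def v_uminus)

lemma at_least_diff: "at_least n z \<Longrightarrow> at_least n w \<Longrightarrow> at_least n (z - w)"
  using at_least_add[of n z "- w"] at_least_uminus[of n w] by simp

lemma at_least_mult: "at_least n z \<Longrightarrow> at_least m w \<Longrightarrow> at_least (n + m) (z * w)"
  by (cases "z = 0"; cases "w = 0") (auto simp: at_least_def v_mult)

lemma at_least_mono: "at_least n z \<Longrightarrow> m \<le> n \<Longrightarrow> at_least m z"
  by (auto simp: at_least_def)

lemma at_least_v: "z \<in> K \<Longrightarrow> at_least (v z) z"
  by (simp add: at_least_def)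

lemma v_add_eq:
  assumes "z \<in> K" "z \<noteq> 0" "at_least n w" "v z < n"
  shows "z + w \<noteq> 0" "v (z + w) = v z"
proof -
  show nz: "z + w \<noteq> 0"
  proof
    assume "z + w = 0"
    then have "z = - w" by (simp add: eq_neg_iff_add_eq_0)
    with assms show False using v_uminus[of w] by (auto simp: at_least_def)
  qed
  have "at_least (v z) (z + w)"
    using assms by (intro at_least_add) (auto simp: at_least_def)
  moreover have "v (z + w) \<le> v z"
  proof (rule ccontr)
    assume "\<not> v (z + w) \<le> v z"
    \<comment> \<open>Subtracting \<open>w\<close> from \<open>z + w\<close> gives back
      \<open>z\<close>, whose value would then be too large.\<close>
    moreover have "at_least (min (v (z + w)) n) (z + w - w)"
      using assms by (intro at_least_diff) (auto simp: at_least_def)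
    ultimately show False using assms by (auto simp: at_least_def)
  qed
  ultimately show "v (z + w) = v z" using nz by (simp add: at_least_def)
qed

lemma at_least_const [simp]: "at_least 0 (fun_of_poly [:c:])"
  using v_const[of c] by (cases "c = 0") (auto simp: at_least_def)

lemma fun_of_poly_pCons: "fun_of_poly (pCons a p) = fun_of_poly [:a:] + fun_of_poly [:0, 1:] * fun_of_poly p"
  by (simp flip: fun_of_poly_add fun_of_poly_mult)

lemma at_least_poly:
  assumes "at_least 0 (fun_of_poly [:0, 1:])"
  shows "at_least 0 (fun_of_poly p)"
proof (induction p)
  case 0
  then show ?case by (simp add: at_least_def)
next
  case (pCons a p)
  then show ?case
    unfolding fun_of_poly_pCons[of a p] using at_least_mult[OF assms pCons.IH]
    by (intro at_least_add) auto
qed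

text \<open>Horner's rule: at a pole of \<open>x\<close> the product of \<open>x\<close> and a
  nonzero polynomial has negative value, so adding a constant does not change that value.\<close>

lemma v_degree:
  assumes inf: "v (fun_of_poly [:0, 1:]) < 0"
  shows "p \<noteq> 0 \<Longrightarrow> v (fun_of_poly p) = int (degree p) * v (fun_of_poly [:0, 1:])"
proof (induction p)
  case (pCons a p)
  show ?case
  proof (cases "p = 0")
    case True
    then show ?thesis using pCons v_const[of a] by simp
  next
    case False
    let ?x = "fun_of_poly [:0, 1:]"
    have v: "v (?x * fun_of_poly p) = (int (degree p) + 1) * v ?x"
      using pCons False by (subst v_mult) (auto simp: algebra_simps)
    have "v (?x * fun_of_poly p) < 0" using inf unfolding v
      by (meson mult_pos_neg add_nonneg_pos of_nat_0_le_iff zero_less_one)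
    with v_add_eq(2)[of "?x * fun_of_poly p" 0 "fun_of_poly [:a:]"] False
    have "v (?x * fun_of_poly p + fun_of_poly [:a:]) = v (?x * fun_of_poly p)"
      by simp
    then show ?thesis using v False
      by (simp add: fun_of_poly_pCons[of a p] add.commute)
  qed
qed simp

end

section \<open>Places over finite values of x\<close>

locale finite_place = place f v for f :: "'k::field poly" and v +
  fixes \<alpha> :: 'k
  assumes above: "0 < v (fun_of_poly [:- \<alpha>, 1:])"
begin

abbreviation "t \<equiv> (fun_of_poly [:- \<alpha>, 1:] :: 'k poly fract alg_closure)"

lemma poly_integral: "at_least 0 (fun_of_poly p)"
proof (rule at_least_poly)
  have "at_least 0 (t + fun_of_poly [:\<alpha>:])"
    using above by (intro at_least_add at_least_const) (auto simp: at_least_def)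
  then show "at_least 0 (fun_of_poly [:0, 1:])" by (simp flip: fun_of_poly_add)
qed

lemma minus_value: "at_least (v t) (fun_of_poly p - fun_of_poly [:poly p \<alpha>:])"
proof -
  have "[:- \<alpha>, 1:] dvd p - [:poly p \<alpha>:]" by (simp add: poly_eq_0_iff_dvd[symmetric])
  then obtain q where "p - [:poly p \<alpha>:] = [:- \<alpha>, 1:] * q" by (elim dvdE)
  then have "fun_of_poly p - fun_of_poly [:poly p \<alpha>:] = t * fun_of_poly q"
    by (metis fun_of_poly_mult fun_of_poly_diff)
  moreover have "at_least (v t + 0) (t * fun_of_poly q)"
    by (intro at_least_mult poly_integral) (auto simp: at_least_def)
  ultimately show ?thesis by simp
qed

lemma v_unit: "poly p \<alpha> \<noteq> 0 \<Longrightarrow> v (fun_of_poly p) = 0"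
  using v_add_eq(2)[OF _ _ minus_value, of "fun_of_poly [:poly p \<alpha>:]" p] above v_const[of "poly p \<alpha>"]
  by simp

lemma v_order:
  assumes "p \<noteq> 0" shows "v (fun_of_poly p) = int (order \<alpha> p) * v t"
proof -
  obtain q where p: "p = [:- \<alpha>, 1:] ^ order \<alpha> p * q" and q: "\<not> [:- \<alpha>, 1:] dvd q"
    using order_decomp[OF assms] by blast
  have "q \<noteq> 0" using p assms by auto
  have "v (fun_of_poly p) = v (t ^ order \<alpha> p * fun_of_poly q)"
    by (subst p) simp
  also have "\<dots> = int (order \<alpha> p) * v t + v (fun_of_poly q)"
    using \<open>q \<noteq> 0\<close> by (simp add: v_mult v_power)
  also have "v (fun_of_poly q) = 0" using q by (intro v_unit) (simp add: poly_eq_0_iff_dvd)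
  finally show ?thesis by simp
qed

lemma y_integral: "at_least 0 (fun_y f)"
proof (cases "fun_y f = 0")
  case False
  have "2 * v (fun_y f) = v (fun_of_poly f)" using v_power[of "fun_y f" 2] False by (simp add: fun_y_square)
  moreover have "0 \<le> v (fun_of_poly f)" using poly_integral[of f] f_nonzero by (simp add: at_least_def)
  ultimately show ?thesis by (simp add: at_least_def)
qed (simp add: at_least_def)

end

locale unramified_place = finite_place f v \<alpha> for f :: "'k::field poly" and v \<alpha> +
  fixes \<eta> :: 'k
  assumes on_curve: "poly f \<alpha> = \<eta>\<^sup>2" and eta: "\<eta> \<noteq> 0" and char: "(2::'k) \<noteq> 0"
    and y_above: "at_least 1 (fun_y f - fun_of_poly [:\<eta>:])"
begin

lemma minus_value_lin:
  "at_least 1 (fun_of_poly a + fun_of_poly b * fun_y f - fun_of_poly [:poly a \<alpha> + poly b \<alpha> * \<eta>:])"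
proof -
  have "at_least 1 (fun_of_poly p - fun_of_poly [:poly p \<alpha>:])" for p
    using minus_value[of p] above at_least_mono by force
  then have "at_least 1 ((fun_of_poly a - fun_of_poly [:poly a \<alpha>:])
        + ((fun_of_poly b - fun_of_poly [:poly b \<alpha>:]) * fun_y f
        + fun_of_poly [:poly b \<alpha>:] * (fun_y f - fun_of_poly [:\<eta>:])))"
    using y_above y_integral at_least_mult[of 1 _ 0] at_least_mult[of 0 _ 1]
    by (intro at_least_add) auto
  moreover have "fun_of_poly [:poly a \<alpha> + poly b \<alpha> * \<eta>:] =
      fun_of_poly [:poly a \<alpha>:] + fun_of_poly [:poly b \<alpha>:] * fun_of_poly [:\<eta>:]"
    by (simp flip: fun_of_poly_mult fun_of_poly_add)
  ultimately show ?thesis by (simp add: algebra_simps)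
qed

lemma v_lin_unit:
  assumes "poly a \<alpha> + poly b \<alpha> * \<eta> \<noteq> 0"
  shows "v (fun_of_poly a + fun_of_poly b * fun_y f) = 0"
  using v_add_eq(2)[OF _ _ minus_value_lin, of "fun_of_poly [:poly a \<alpha> + poly b \<alpha> * \<eta>:]" a b] assms
    v_const[OF assms] by simp

text \<open>The conjugate \<open>a - b y\<close> takes the nonzero value
  \<open>2 * a(\<alpha>)\<close> at the point, so it is a unit there and \<open>a + b y\<close>
  carries the whole value of the norm.\<close>

lemma v_lin_zero:
  assumes "poly a \<alpha> + poly b \<alpha> * \<eta> = 0" "poly a \<alpha> \<noteq> 0"
  shows "v (fun_of_poly a + fun_of_poly b * fun_y f) = v (fun_of_poly (a\<^sup>2 - f * b\<^sup>2))"
proof -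
  have "poly a \<alpha> + poly (- b) \<alpha> * \<eta> = 2 * poly a \<alpha>"
    using assms(1) by (simp add: add_eq_0_iff)
  then have "v (fun_of_poly a + fun_of_poly (- b) * fun_y f) = 0"
    using assms(2) char by (intro v_lin_unit) auto
  moreover have "(fun_of_poly a + fun_of_poly b * fun_y f) * (fun_of_poly a + fun_of_poly (- b) * fun_y f)
      = fun_of_poly (a\<^sup>2 - f * b\<^sup>2)"
    by (simp add: algebra_simps power2_eq_square flip: fun_y_square[of f])
  moreover have "a \<noteq> 0" using assms by auto
  ultimately show ?thesis
    using v_mult[of "fun_of_poly a + fun_of_poly b * fun_y f" "fun_of_poly a + fun_of_poly (- b) * fun_y f"]
      independent_iff[of a b] independent_iff[of a "- b"]
    by (simp del: fun_of_poly_diff fun_of_poly_minus)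
qed

end

text \<open>The place over the point with coordinates \<alpha> and \<eta>. The equality in the last
  conjunct covers the zero function, on which \<open>v\<close> is 0 by convention.\<close>

definition unram_at :: "'k::field poly \<Rightarrow> 'k \<Rightarrow> 'k \<Rightarrow> 'k place \<Rightarrow> bool" where
  "unram_at f \<alpha> \<eta> v \<longleftrightarrow> v \<in> curve_points f \<and> 0 < v (fun_of_poly [:- \<alpha>, 1:]) \<and>
     (fun_y f = fun_of_poly [:\<eta>:] \<or> 0 < v (fun_y f - fun_of_poly [:\<eta>:]))"

lemma (in odd_hyperelliptic) unram_at_locale:
  assumes "unram_at f \<alpha> \<eta> v" "poly f \<alpha> = \<eta>\<^sup>2" "\<eta> \<noteq> 0" "(2::'k) \<noteq> 0"
  shows "unramified_place f v \<alpha> \<eta>"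
proof -
  interpret place f v using assms(1) by unfold_locales (simp add: unram_at_def)
  show ?thesis using assms by unfold_locales (auto simp: unram_at_def at_least_def)
qed

text \<open>The multiplier \<open>n\<close> depends on \<open>z\<close> but not on \<open>v\<close>;
  this yields both that \<open>x - \<alpha>\<close> is a uniformiser and that the place is unique.
  Once the largest common power of \<open>x - \<alpha>\<close> is removed from \<open>a\<close> and
  \<open>b\<close>, the numerator is either a unit at the point or has the value of its
  norm.\<close>

lemma (in odd_hyperelliptic) unram_at_value:
  assumes eta: "poly f \<alpha> = \<eta>\<^sup>2" "\<eta> \<noteq> 0" "(2::'k) \<noteq> 0"
    and z: "z \<in> function_field f" "z \<noteq> 0"
  obtains n where "\<And>v. unram_at f \<alpha> \<eta> v \<Longrightarrow> v z = n * v (fun_of_poly [:- \<alpha>, 1:])"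
proof -
  let ?t = "[:- \<alpha>, 1:]"
  obtain a b c where c: "c \<noteq> 0" and zz: "z = (fun_of_poly a + fun_of_poly b * fun_y f) / fun_of_poly c"
    using z(1) by (rule function_fieldE)
  have ab: "a \<noteq> 0 \<or> b \<noteq> 0" using z(2) zz by auto
  define P where "P n \<longleftrightarrow> ?t ^ n dvd a \<and> ?t ^ n dvd b" for n
  have bound: "\<exists>N. \<forall>n. P n \<longrightarrow> n \<le> N"
  proof -
    have "n \<le> (if a \<noteq> 0 then order \<alpha> a else order \<alpha> b)" if "P n" for n
      using that ab order_divides[of \<alpha> n a] order_divides[of \<alpha> n b] by (auto simp: P_def)
    then show ?thesis by blast
  qed
  have "P 0" by (simp add: P_def)
  define n where "n = (GREATEST n. P n)"
  have n: "P n" unfolding n_def using bound \<open>P 0\<close> by (metis GreatestI_nat)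
  have Sn: "\<not> P (Suc n)" unfolding n_def using bound
    by (metis Greatest_le_nat Suc_n_not_le_n)
  obtain a' b' where a': "a = ?t ^ n * a'" and b': "b = ?t ^ n * b'"
    using n unfolding P_def by (meson dvdE)
  have ab0: "poly a' \<alpha> \<noteq> 0 \<or> poly b' \<alpha> \<noteq> 0"
  proof (rule ccontr)
    assume "\<not> ?thesis"
    then have "?t dvd a'" "?t dvd b'" by (auto simp: poly_eq_0_iff_dvd)
    then have "P (Suc n)" unfolding P_def a' b' power_Suc2
      by (intro conjI mult_dvd_mono dvd_refl)
    with Sn show False by simp
  qed
  let ?w = "fun_of_poly a' + fun_of_poly b' * fun_y f"
  have "a' \<noteq> 0 \<or> b' \<noteq> 0" using ab0 by auto
  then have w0: "?w \<noteq> 0" and norm0: "a'\<^sup>2 - f * b'\<^sup>2 \<noteq> 0"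
    using independent_iff norm_nonzero by blast+
  have z_eq: "z = fun_of_poly (?t ^ n) * ?w / fun_of_poly c"
    by (simp add: zz a' b' algebra_simps)
  define m where "m = (if poly a' \<alpha> + poly b' \<alpha> * \<eta> = 0 then int (order \<alpha> (a'\<^sup>2 - f * b'\<^sup>2)) else 0)"
  have "v z = (int n + m - int (order \<alpha> c)) * v (fun_of_poly ?t)" if "unram_at f \<alpha> \<eta> v" for v
  proof -
    interpret unramified_place f v \<alpha> \<eta> using that eta by (rule unram_at_locale)
    have "v ?w = m * v t"
    proof (cases "poly a' \<alpha> + poly b' \<alpha> * \<eta> = 0")
      case True
      with ab0 have "poly a' \<alpha> \<noteq> 0" using eta by auto
      then show ?thesis using v_lin_zero[OF True] v_order[OF norm0] True by (simp add: m_def)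
    next
      case False
      then show ?thesis using v_lin_unit by (simp add: m_def)
    qed
    moreover have "v z = v (fun_of_poly (?t ^ n)) + v ?w - v (fun_of_poly c)"
      unfolding z_eq using w0 c by (subst v_divide v_mult; simp)+
    ultimately show ?thesis
      using v_order[OF c] by (simp add: v_power algebra_simps)
  qed
  with that show ?thesis by blast
qed

text \<open>Some function has value 1, and that value is an integer multiple of the positive number
  \<open>v t\<close>.\<close>

lemma (in odd_hyperelliptic) unram_at_uniformiser:
  assumes "poly f \<alpha> = \<eta>\<^sup>2" "\<eta> \<noteq> 0" "(2::'k) \<noteq> 0" and v: "unram_at f \<alpha> \<eta> v"
  shows "v (fun_of_poly [:- \<alpha>, 1:]) = 1"
proof -
  interpret unramified_place f v \<alpha> \<eta> using v assms(1-3) by (rule unram_at_locale)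
  obtain z where z: "z \<in> K" "z \<noteq> 0" "v z = 1" by (rule uniformiser)
  obtain n where "v z = n * v t" using unram_at_value[OF assms(1-3) z(1,2)] v by metis
  then show ?thesis using z above pos_zmult_eq_1_iff_lemma[of "v t" n]
    by (metis mult.commute zmult_eq_1_iff less_minus_one_simps(1) not_less_iff_gr_or_eq)
qed

lemma (in odd_hyperelliptic) unram_at_unique:
  assumes "poly f \<alpha> = \<eta>\<^sup>2" "\<eta> \<noteq> 0" "(2::'k) \<noteq> 0"
    and v: "unram_at f \<alpha> \<eta> v" and v': "unram_at f \<alpha> \<eta> v'"
  shows "v = v'"
proof
  fix z
  interpret v: place f v using v by unfold_locales (simp add: unram_at_def)
  interpret v': place f v' using v' by unfold_locales (simp add: unram_at_def)
  show "v z = v' z"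
  proof (cases "z \<in> function_field f \<and> z \<noteq> 0")
    case True
    then obtain n where "\<And>v. unram_at f \<alpha> \<eta> v \<Longrightarrow> v z = n * v (fun_of_poly [:- \<alpha>, 1:])"
      using unram_at_value[OF assms(1-3)] by metis
    then show ?thesis using unram_at_uniformiser assms by metis
  next
    case False
    then show ?thesis using v.v_outside v'.v_outside by auto
  qed
qed

section \<open>The place at infinity\<close>

locale infinite_place = place f v for f :: "'k::field poly" and v +
  assumes pole: "v (fun_of_poly [:0, 1:]) < 0"
begin

abbreviation "x \<equiv> (fun_of_poly [:0, 1:] :: 'k poly fract alg_closure)"

lemma fun_y_nonzero: "fun_y f \<noteq> 0"
  using fun_y_square[of f] f_nonzero by auto

lemma v_y: "2 * v (fun_y f) = int (degree f) * v x"
  using v_power[of "fun_y f" 2] fun_y_nonzero v_degree[OF pole f_nonzero] by (simp add: fun_y_square)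

text \<open>The values of \<open>a\<close> and \<open>b y\<close> differ, since
  \<open>a\<^sup>2\<close> and \<open>f * b\<^sup>2\<close> have degrees of different parity; the
  smaller value decides, just as the larger degree decides that of the norm. Doubling avoids the
  half-integer multiple of \<open>v x\<close> that is the value of \<open>y\<close>.\<close>

lemma v_lin:
  assumes "a \<noteq> 0 \<or> b \<noteq> 0"
  shows "2 * v (fun_of_poly a + fun_of_poly b * fun_y f) = int (degree (a\<^sup>2 - f * b\<^sup>2)) * v x"
proof -
  let ?A = "fun_of_poly a" and ?B = "fun_of_poly b * fun_y f"
  have A: "2 * v ?A = int (degree (a\<^sup>2)) * v x" if "a \<noteq> 0"
    using that v_degree[OF pole that] by (simp add: power2_eq_square degree_mult_eq)
  have B: "2 * v ?B = int (degree (f * b\<^sup>2)) * v x" if "b \<noteq> 0"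
    using that v_degree[OF pole that] v_y f_nonzero fun_y_nonzero
    by (simp add: v_mult power2_eq_square degree_mult_eq algebra_simps)
  consider "a = 0" "b \<noteq> 0" | "b = 0" "a \<noteq> 0" | "a \<noteq> 0" "b \<noteq> 0" using assms by blast
  then show ?thesis
  proof cases
    case 3
    let ?p = "a\<^sup>2" and ?q = "f * b\<^sup>2"
    have "degree ?p \<noteq> degree ?q"
    proof
      assume "degree ?p = degree ?q"
      then have "2 * degree a = degree f + 2 * degree b"
        using 3 f_nonzero by (simp add: power2_eq_square degree_mult_eq)
      then show False using odd_degree by presburger
    qed
    then consider "degree ?p < degree ?q" | "degree ?q < degree ?p" by linarith
    then show ?thesis
    proof cases
      case 1
      then have "int (degree ?q) * v x < int (degree ?p) * v x"
        using pole by simp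
      then have "v ?B < v ?A" using A B 3 by linarith
      then have "v (?B + ?A) = v ?B"
        using 3 fun_y_nonzero by (intro v_add_eq(2)[of _ "v ?A"] at_least_v) auto
      moreover have "degree (?p - ?q) = degree ?q"
        using 1 degree_add_eq_right[of ?p "- ?q"] by simp
      ultimately show ?thesis using B 3 by (simp add: add.commute)
    next
      case 2
      then have "int (degree ?p) * v x < int (degree ?q) * v x"
        using pole by simp
      then have "v ?A < v ?B" using A B 3 by linarith
      then have "v (?A + ?B) = v ?A"
        using 3 fun_y_nonzero by (intro v_add_eq(2)[of _ "v ?B"] at_least_v) auto
      moreover have "degree (?p - ?q) = degree ?p"
        using 2 degree_add_eq_left[of "- ?q" ?p] by simp
      ultimately show ?thesis using A 3 by simp
    qed
  qed (use A B in auto)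
qed

end

text \<open>As \<open>2 * v y\<close> is an odd multiple of \<open>v x\<close>, the number
  \<open>v x\<close> is even, and all values are multiples of its half. Since 1 is a value, the half
  is 1 or -1, and the pole decides the sign.\<close>

lemma (in odd_hyperelliptic) infinite_place_x:
  assumes "infinite_place f v"
  shows "v (fun_of_poly [:0, 1:]) = - 2"
proof -
  interpret infinite_place f v by fact
  obtain z where z: "z \<in> K" "z \<noteq> 0" "v z = 1" by (rule uniformiser)
  obtain a b c where c: "c \<noteq> 0" and zz: "z = (fun_of_poly a + fun_of_poly b * fun_y f) / fun_of_poly c"
    using z(1) by (rule function_fieldE)
  then have ab: "a \<noteq> 0 \<or> b \<noteq> 0" using z(2) by auto
  have "even (v x)" using v_y odd_degree by (metis dvd_triv_left even_mult_iff even_of_nat)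
  then obtain k where k: "v x = 2 * k" by blast
  have "2 * v z = (int (degree (a\<^sup>2 - f * b\<^sup>2)) - 2 * int (degree c)) * v x"
    using v_lin[OF ab] v_degree[OF pole c] c ab independent_iff[of a b]
    by (simp add: zz v_divide algebra_simps)
  then have "1 = (int (degree (a\<^sup>2 - f * b\<^sup>2)) - 2 * int (degree c)) * k" using z k by simp
  then have "k = 1 \<or> k = - 1" by (metis mult.commute zmult_eq_1_iff)
  then show ?thesis using pole k by auto
qed

text \<open>Once the value of \<open>x\<close> is known, \<open>v_lin\<close> and
  \<open>v_degree\<close> express every value by degrees alone.\<close>

lemma (in odd_hyperelliptic) infinite_place_unique:
  assumes v: "infinite_place f v" and v': "infinite_place f v'"
  shows "v = v'"
proof
  fix z
  interpret v: infinite_place f v by fact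
  interpret v': infinite_place f v' by fact
  show "v z = v' z"
  proof (cases "z \<in> function_field f \<and> z \<noteq> 0")
    case True
    then obtain a b c where c: "c \<noteq> 0" and zz: "z = (fun_of_poly a + fun_of_poly b * fun_y f) / fun_of_poly c"
      using function_fieldE by metis
    then have ab: "a \<noteq> 0 \<or> b \<noteq> 0" using True by auto
    have "v z = 2 * int (degree c) - int (degree (a\<^sup>2 - f * b\<^sup>2))" if "infinite_place f v" for v
    proof -
      interpret infinite_place f v by fact
      show ?thesis
        using v_lin[OF ab] v_degree[OF pole c] c ab independent_iff[of a b] infinite_place_x[OF that]
        by (simp add: zz v_divide algebra_simps)
    qed
    then show ?thesis using assms by metis
  next
    case False
    then show ?thesis using v.v_outside v'.v_outside by auto
  qed
qed

section \<open>Existence of places\<close>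

lemma map_poly_hom_add:
  assumes "h 0 = 0" "\<And>a b. h (a + b) = h a + h b"
  shows "map_poly h (p + q) = map_poly h p + map_poly h q"
  by (intro poly_eqI) (simp add: coeff_map_poly assms)

lemma map_poly_hom_mult:
  fixes h :: "'a::comm_ring_1 \<Rightarrow> 'b::comm_ring_1"
  assumes "h 0 = 0" "\<And>a b. h (a + b) = h a + h b" "\<And>a b. h (a * b) = h a * h b"
  shows "map_poly h (p * q) = map_poly h p * map_poly h q"
proof (induction p)
  case (pCons a p)
  have "map_poly h (pCons a p * q) = map_poly h (smult a q) + map_poly h (pCons 0 (p * q))"
    by (simp add: map_poly_hom_add assms)
  also have "map_poly h (smult a q) = smult (h a) (map_poly h q)"
    by (intro poly_eqI) (simp add: coeff_map_poly assms)
  finally show ?case using pCons by (simp add: map_poly_pCons assms)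
qed simp

lemma fps_sqrt_exists:
  fixes a :: "'k::field_char_0 fps"
  assumes "a $ 0 = e\<^sup>2" "e \<noteq> 0"
  obtains b where "b\<^sup>2 = a" "b $ 0 = e"
proof -
  let ?b = "fps_radical (\<lambda>_ _. e) (Suc 1) a"
  have "?b ^ Suc 1 = a"
    using assms by (subst power_radical[symmetric]) (auto simp: power2_eq_square)
  then show ?thesis using that[of ?b] by (simp add: numeral_2_eq_2)
qed

lemma fps_of_poly_pcompose_nth_0:
  "fps_of_poly (pcompose p q) $ 0 = poly p (poly q 0)"
  by (simp add: poly_0_coeff_0[symmetric] poly_pcompose)

text \<open>The curve is parametrised by \<open>x = q(s)\<close>, \<open>y = Y(s)\<close> with a
  power series \<open>Y\<close>; a nonconstant \<open>q\<close> makes the substitution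
  injective.\<close>

lemma curve_hom_pcompose:
  fixes f :: "'k::field poly"
  assumes "odd (degree f)" "degree q > 0" "Y\<^sup>2 = fps_of_poly (pcompose f q)"
  shows "curve_hom f (\<lambda>p. fps_to_fls (fps_of_poly (pcompose p q))) (fps_to_fls Y)"
proof
  show "p = 0" if "fps_to_fls (fps_of_poly (pcompose p q)) = 0" for p
    using that assms(2) by (simp add: pcompose_eq_0_iff)
  show "(fps_to_fls Y)\<^sup>2 = fps_to_fls (fps_of_poly (pcompose f q))"
    using assms(3) by (metis fps_to_fls_power)
qed (use assms in \<open>simp_all add: pcompose_add pcompose_mult fps_of_poly_add fps_of_poly_mult fls_times_fps_to_fls\<close>)

text \<open>The parametrisation is \<open>x = \<alpha> + s\<close>, with \<open>y\<close> the power
  series square root of \<open>f(\<alpha> + s)\<close> that has constant term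
  \<open>\<eta>\<close>.\<close>

lemma unram_at_exists:
  fixes f :: "'k::field_char_0 poly"
  assumes odd: "odd (degree f)" and "poly f \<alpha> = \<eta>\<^sup>2" "\<eta> \<noteq> 0"
  obtains v where "unram_at f \<alpha> \<eta> v"
proof -
  interpret odd_hyperelliptic f by unfold_locales fact
  let ?q = "[:\<alpha>, 1:]"
  have "fps_of_poly (pcompose f ?q) $ 0 = \<eta>\<^sup>2"
    unfolding fps_of_poly_pcompose_nth_0 by (simp add: assms)
  then obtain Y where Y: "Y\<^sup>2 = fps_of_poly (pcompose f ?q)" "Y $ 0 = \<eta>"
    using assms(3) by (rule fps_sqrt_exists)
  interpret H: curve_hom f "\<lambda>p. fps_to_fls (fps_of_poly (pcompose p ?q))" "fps_to_fls Y"
    using odd Y by (intro curve_hom_pcompose) auto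
  define v where "v \<equiv> \<lambda>z. if z \<in> function_field f then fls_subdegree (H.ext z) else 0"
  have t: "H.ext (fun_of_poly [:- \<alpha>, 1:]) = fls_X"
    by (simp add: pcompose_pCons fps_of_poly_pCons)
  have "v \<in> curve_points f"
    unfolding v_def
    by (rule place_of_series[OF H.curve_hom_axioms _ _, of "fun_of_poly [:- \<alpha>, 1:]"]) (simp_all add: t pcompose_pCons fps_of_poly_const del: H.ext_fun_of_poly)
  moreover have "v (fun_of_poly [:- \<alpha>, 1:]) = 1"
    by (simp add: v_def t del: H.ext_fun_of_poly)
  moreover have "0 < v (fun_y f - fun_of_poly [:\<eta>:])" if "fun_y f \<noteq> fun_of_poly [:\<eta>:]"
  proof -
    let ?z = "fun_y f - fun_of_poly [:\<eta>:]"
    have "H.ext ?z = fps_to_fls (Y - fps_const \<eta>)"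
      using H.ext_add[of "fun_y f" "fun_of_poly [:- \<eta>:]"] fun_of_poly_minus[of "[:\<eta>:]"]
      by (simp add: fps_of_poly_const flip: fps_const_neg)
    moreover have "H.ext ?z \<noteq> 0" using that by (intro H.ext_nonzero) auto
    ultimately have "fls_subdegree (H.ext ?z) = int (subdegree (Y - fps_const \<eta>))" "Y - fps_const \<eta> \<noteq> 0"
      by (auto simp: fls_subdegree_fls_to_fps simp del: fps_to_fls_minus)
    moreover have "subdegree (Y - fps_const \<eta>) \<noteq> 0"
      using Y(2) calculation(2) subdegree_eq_0_iff[of "Y - fps_const \<eta>"] by simp
    ultimately show ?thesis by (simp add: v_def)
  qed
  ultimately show ?thesis using that[of v] by (auto simp: unram_at_def)
qed

text \<open>At a simple root write \<open>f = (x - \<alpha>) g\<close>. With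
  \<open>x = \<alpha> + s^2\<close> one may take for \<open>y\<close> the product of
  \<open>s\<close> and a square root of \<open>g(\<alpha> + s^2)\<close>, which exists because
  \<open>g(\<alpha>)\<close> is nonzero.\<close>

lemma ramified_place_exists:
  fixes f :: "'k::{field_char_0, alg_closed_field} poly"
  assumes odd: "odd (degree f)" and root: "poly f \<alpha> = 0" "poly (pderiv f) \<alpha> \<noteq> 0"
  obtains v where "v \<in> curve_points f" "v (fun_of_poly [:- \<alpha>, 1:]) = 2"
proof -
  interpret odd_hyperelliptic f by unfold_locales fact
  let ?q = "[:\<alpha>, 0, 1:]"
  obtain g where f: "f = [:- \<alpha>, 1:] * g" using root(1) by (auto simp: poly_eq_0_iff_dvd elim: dvdE)
  have "poly (pderiv f) \<alpha> = poly g \<alpha>"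
    by (simp only: f pderiv_mult poly_add poly_mult) (simp add: pderiv_pCons)
  then have "poly g \<alpha> \<noteq> 0" using root(2) by simp
  obtain \<beta> where \<beta>: "\<beta>\<^sup>2 = poly g \<alpha>" using nth_root_exists[of 2 "poly g \<alpha>"] by auto
  have "\<beta> \<noteq> 0" using \<beta> \<open>poly g \<alpha> \<noteq> 0\<close> by auto
  have "fps_of_poly (pcompose g ?q) $ 0 = \<beta>\<^sup>2"
    unfolding fps_of_poly_pcompose_nth_0 by (simp add: \<beta>)
  then obtain Z where Z: "Z\<^sup>2 = fps_of_poly (pcompose g ?q)" "Z $ 0 = \<beta>"
    using \<open>\<beta> \<noteq> 0\<close> by (rule fps_sqrt_exists)
  have q: "fps_of_poly (pcompose [:- \<alpha>, 1:] ?q) = fps_X\<^sup>2"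
    by (simp add: pcompose_pCons fps_of_poly_pCons power2_eq_square)
  have Y: "(fps_X * Z)\<^sup>2 = fps_of_poly (pcompose f ?q)"
    unfolding f pcompose_mult fps_of_poly_mult q by (simp add: power_mult_distrib Z)
  interpret H: curve_hom f "\<lambda>p. fps_to_fls (fps_of_poly (pcompose p ?q))" "fps_to_fls (fps_X * Z)"
    using odd Y by (intro curve_hom_pcompose) auto
  define v where "v \<equiv> \<lambda>z. if z \<in> function_field f then fls_subdegree (H.ext z) else 0"
  have "subdegree Z = 0" "Z \<noteq> 0" using Z(2) \<open>\<beta> \<noteq> 0\<close> by auto
  then have "fls_subdegree (H.ext (fun_y f)) = 1"
    by (simp add: fls_subdegree_fls_to_fps)
  then have "v \<in> curve_points f"
    unfolding v_def
    by (intro place_of_series[OF H.curve_hom_axioms _ _, of "fun_y f"]) (simp_all add: pcompose_pCons fps_of_poly_const)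
  moreover have "v (fun_of_poly [:- \<alpha>, 1:]) = 2"
  proof -
    have "H.ext (fun_of_poly [:- \<alpha>, 1:]) = fps_to_fls (fps_X\<^sup>2)"
      by (simp only: H.ext_fun_of_poly q)
    then show ?thesis by (simp add: v_def fls_subdegree_fls_to_fps del: H.ext_fun_of_poly)
  qed
  ultimately show ?thesis using that by blast
qed

lemma fls_poly_even:
  "poly (map_poly fls_const p) (fls_X\<^sup>2) = fps_to_fls (fps_of_poly (pcompose p [:0, 0, 1:]))"
proof (induction p)
  case (pCons a p)
  have "fps_of_poly [:0, 0, 1 :: 'a:] = fps_X\<^sup>2"
    by (simp add: fps_of_poly_pCons power2_eq_square)
  then have "fps_of_poly (pcompose (pCons a p) [:0, 0, 1:])
      = fps_const a + fps_X\<^sup>2 * fps_of_poly (pcompose p [:0, 0, 1:])"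
    by (simp only: pcompose_pCons fps_of_poly_add fps_of_poly_mult fps_of_poly_const)
  then show ?case using pCons
    by (simp add: map_poly_pCons fls_times_fps_to_fls fps_to_fls_power)
qed simp

text \<open>The parametrisation is \<open>x = s^(-2)\<close>, with \<open>y\<close> the product of
  \<open>s^(-deg f)\<close> and a square root of the reversed polynomial of \<open>f\<close> at
  \<open>s^2\<close>, a power series whose constant term is the leading coefficient of
  \<open>f\<close>. The negative exponent leaves power series, so \<open>\<psi>\<close> evaluates
  polynomials in Laurent series instead of composing them.\<close>

lemma infinite_place_exists:
  fixes f :: "'k::{field_char_0, alg_closed_field} poly"
  assumes odd: "odd (degree f)"
  obtains v where "infinite_place f v"
proof -
  interpret odd_hyperelliptic f by unfold_locales fact
  define \<psi> where "\<psi> p = poly (map_poly fls_const p) (fls_X_inv\<^sup>2)" for p :: "'k poly"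
  define rev where "rev p = fps_of_poly (pcompose (reflect_poly p) [:0, 0, 1:])" for p :: "'k poly"
  have rev: "fps_to_fls (rev p) = fls_X ^ (2 * degree p) * \<psi> p" for p :: "'k poly"
  proof -
    have "map_poly fls_const (reflect_poly p) = reflect_poly (map_poly fls_const p)"
      by (intro poly_eqI) (simp add: coeff_map_poly coeff_reflect_poly degree_map_poly)
    then have "fps_to_fls (rev p) = poly (reflect_poly (map_poly fls_const p)) (fls_X\<^sup>2)"
      unfolding rev_def by (simp flip: fls_poly_even)
    also have "\<dots> = (fls_X\<^sup>2) ^ degree p * \<psi> p"
      unfolding \<psi>_def fls_inverse_X[symmetric] power_inverse
      by (subst poly_reflect_poly_nz) (auto simp: degree_map_poly)
    finally show ?thesis by (simp add: power_mult)
  qed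
  have rev0: "rev p $ 0 = lead_coeff p" for p :: "'k poly"
    unfolding rev_def fps_of_poly_pcompose_nth_0 by simp
  have sub: "fls_subdegree (\<psi> p) = - 2 * int (degree p) \<and> \<psi> p \<noteq> 0" if "p \<noteq> 0" for p
  proof -
    have "rev p $ 0 \<noteq> 0" using that by (simp add: rev0)
    then have "fls_subdegree (fps_to_fls (rev p)) = 0" "fps_to_fls (rev p) \<noteq> 0"
      by (auto simp: fls_subdegree_fls_to_fps)
    then show ?thesis unfolding rev by (auto simp: fls_subdegree_mult)
  qed
  obtain \<beta> where \<beta>: "\<beta>\<^sup>2 = lead_coeff f" using nth_root_exists[of 2 "lead_coeff f"] by auto
  then have "\<beta> \<noteq> 0" using f_nonzero by auto
  obtain Z where Z: "Z\<^sup>2 = rev f" "Z $ 0 = \<beta>"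
    using fps_sqrt_exists[of "rev f" \<beta>] \<open>\<beta> \<noteq> 0\<close> by (auto simp: rev0 \<beta>)
  define Y where "Y = fls_X_inv ^ degree f * fps_to_fls Z"
  have "Y\<^sup>2 = (fls_X_inv ^ (2 * degree f)) * fps_to_fls (rev f)"
    by (simp add: Y_def power_mult_distrib power_mult[symmetric] mult.commute flip: fps_to_fls_power Z(1))
  also have "\<dots> = (fls_X_inv * fls_X) ^ (2 * degree f) * \<psi> f"
    by (simp only: rev power_mult_distrib mult.assoc)
  also have "fls_X_inv * fls_X = (1 :: 'k fls)" by (simp add: fls_inverse_X[symmetric])
  finally have Y: "Y\<^sup>2 = \<psi> f" by simp
  have psi_smult: "\<psi> (smult a p) = fls_const a * \<psi> p" for a p
    unfolding \<psi>_def by (subst map_poly_smult) (auto)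
  have psi_add: "\<psi> (p + q) = \<psi> p + \<psi> q" for p q
    unfolding \<psi>_def by (subst map_poly_hom_add) (auto simp: fls_plus_const)
  have psi_pCons: "\<psi> (pCons a p) = fls_const a + fls_X_inv\<^sup>2 * \<psi> p" for a p
    unfolding \<psi>_def by (simp add: map_poly_pCons)
  have psi_mult: "\<psi> (p * q) = \<psi> p * \<psi> q" for p q
    by (induction p) (simp_all add: psi_add psi_smult psi_pCons algebra_simps, simp add: \<psi>_def)
  interpret H: curve_hom f \<psi> Y
    using Y psi_add psi_mult sub by unfold_locales blast+
  define v where "v \<equiv> \<lambda>z. if z \<in> function_field f then fls_subdegree (H.ext z) else 0"
  obtain g where g: "degree f = 2 * g + 1" using odd by (auto elim: oddE)
  \<comment> \<open>With \<open>deg f = 2g + 1\<close> this is \<open>x^g / y\<close>, of value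
    \<open>-2g + (2g + 1) = 1\<close>, expanded by \<open>y\<close> to make the denominator a
    polynomial.\<close>
  define z where "z = (fun_of_poly 0 + fun_of_poly ([:0, 1:] ^ g) * fun_y f) / fun_of_poly f"
  have z: "z \<in> function_field f" unfolding z_def using f_nonzero by blast
  have Ysub: "fls_subdegree Y = - int (degree f) \<and> Y \<noteq> 0"
    using Z(2) \<open>\<beta> \<noteq> 0\<close> unfolding Y_def
    by (subst fls_subdegree_mult) (auto simp: fls_subdegree_fls_to_fps)
  have "H.ext z = \<psi> ([:0, 1:] ^ g) * Y / \<psi> f"
    unfolding z_def H.ext_eq[OF f_nonzero] by (simp add: H.hom_0)
  also have "fls_subdegree \<dots> = 1"
    using sub[of "[:0, 1:] ^ g"] sub[OF f_nonzero] Ysub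
    by (subst fls_divide_subdegree fls_subdegree_mult; simp add: degree_power_eq g)+
  finally have "fls_subdegree (H.ext z) = 1" .
  then have "v \<in> curve_points f"
    unfolding v_def
    by (intro place_of_series[OF H.curve_hom_axioms _ z]) (simp_all add: \<psi>_def map_poly_pCons)
  moreover have "v (fun_of_poly [:0, 1:]) = - 2"
    using sub[of "[:0, 1:]"] by (simp add: v_def)
  ultimately have "infinite_place f v" by unfold_locales auto
  then show ?thesis using that by blast
qed

section \<open>The Galois action and the degree zero class group\<close>

lemma divisor_degree_superset:
  assumes "finite A" "Poly_Mapping.keys D \<subseteq> A"
  shows "divisor_degree D = (\<Sum>P\<in>A. Poly_Mapping.lookup D P)"
  unfolding divisor_degree_def using assms by (intro sum.mono_neutral_left) (auto simp: in_keys_iff)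

lemma divisor_degree_diff: "divisor_degree (D - E) = divisor_degree D - divisor_degree E"
proof -
  let ?A = "Poly_Mapping.keys D \<union> Poly_Mapping.keys E"
  have "Poly_Mapping.keys (D - E) \<subseteq> ?A" by (rule keys_diff)
  then show ?thesis
    by (simp add: divisor_degree_superset[of ?A] lookup_minus sum_subtractf)
qed

lemma divisor_degree_0 [simp]: "divisor_degree 0 = 0"
  by (simp add: divisor_degree_def)

lemma divisor_degree_uminus: "divisor_degree (- D) = - divisor_degree D"
  using divisor_degree_diff[of 0 D] by simp

lemma divisor_degree_add: "divisor_degree (D + E) = divisor_degree D + divisor_degree E"
  using divisor_degree_diff[of D "- E"] by (simp add: divisor_degree_uminus)

lemma divisor_degree_frag_of [simp]: "divisor_degree (frag_of P) = 1"
  by (simp add: divisor_degree_def)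

lemma div0_group_simps:
  "carrier (div0_group f) = {D. Poly_Mapping.keys D \<subseteq> curve_points f \<and> divisor_degree D = 0}"
  "x \<otimes>\<^bsub>div0_group f\<^esub> y = x + y"
  "\<one>\<^bsub>div0_group f\<^esub> = 0"
  by (auto simp: div0_group_def free_Abelian_group_def)

lemma div0_comm_group: "comm_group (div0_group f)"
proof -
  interpret F: comm_group "free_Abelian_group (curve_points f)" by (rule abelian_free_Abelian_group)
  let ?S = "{D \<in> carrier (free_Abelian_group (curve_points f)). divisor_degree D = 0}"
  have "subgroup ?S (free_Abelian_group (curve_points f))"
  proof (rule F.subgroupI)
    show "?S \<noteq> {}" by (intro exI[of _ 0] notI) (auto simp: set_eq_iff intro!: exI[of _ 0])
  qed (auto simp: divisor_degree_uminus divisor_degree_add dest!: subsetD[OF keys_add])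
  then have "group (div0_group f)"
    unfolding div0_group_def by (rule F.subgroup_imp_group)
  then show ?thesis
    by (rule group.group_comm_groupI) (simp add: div0_group_simps add.commute)
qed

lemma (in odd_hyperelliptic) principal_divisors_subgroup:
  "subgroup (principal_divisors f) (div0_group f)"
proof -
  interpret G: comm_group "div0_group f" by (rule div0_comm_group)
  have vm: "P (z * w) = P z + P w"
    if "P \<in> curve_points f" "z \<in> function_field f - {0}" "w \<in> function_field f - {0}" for P z w
    using that unfolding curve_points_def by blast
  have inv: "inv\<^bsub>div0_group f\<^esub> D = - D" if "D \<in> carrier (div0_group f)" for D
    using that by (intro G.inv_equality) (auto simp: div0_group_simps divisor_degree_uminus)
  show ?thesis
  proof (rule G.subgroupI)
    have "P 1 = 0" if "P \<in> curve_points f" for P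
      using vm[OF that, of 1 1] by simp
    then have "0 \<in> principal_divisors f"
      unfolding principal_divisors_def using G.one_closed
      by (auto simp: div0_group_simps intro!: bexI[of _ 1])
    then show "principal_divisors f \<noteq> {}" by blast
  next
    fix D assume D: "D \<in> principal_divisors f"
    then obtain z where z: "z \<in> function_field f - {0}" "\<And>P. P \<in> curve_points f \<Longrightarrow> Poly_Mapping.lookup D P = P z"
      unfolding principal_divisors_def by blast
    have "Poly_Mapping.lookup (- D) P = P (inverse z)" if "P \<in> curve_points f" for P
      using vm[OF that, of z "inverse z"] vm[OF that, of 1 1] z that by simp
    moreover have "inverse z \<in> function_field f - {0}" using z by auto
    moreover have "- D \<in> carrier (div0_group f)"
      using D by (auto simp: principal_divisors_def div0_group_simps divisor_degree_uminus)
    ultimately have "- D \<in> principal_divisors f" unfolding principal_divisors_def by blast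
    then show "inv\<^bsub>div0_group f\<^esub> D \<in> principal_divisors f"
      using D inv by (simp add: principal_divisors_def)
  next
    fix D E assume DE: "D \<in> principal_divisors f" "E \<in> principal_divisors f"
    then obtain z w where z: "z \<in> function_field f - {0}" "\<And>P. P \<in> curve_points f \<Longrightarrow> Poly_Mapping.lookup D P = P z"
      and w: "w \<in> function_field f - {0}" "\<And>P. P \<in> curve_points f \<Longrightarrow> Poly_Mapping.lookup E P = P w"
      unfolding principal_divisors_def by blast
    have "D \<otimes>\<^bsub>div0_group f\<^esub> E \<in> carrier (div0_group f)"
      using DE by (intro G.m_closed) (auto simp: principal_divisors_def)
    moreover have "z * w \<in> function_field f - {0}" using z w by auto
    moreover have "Poly_Mapping.lookup (D + E) P = P (z * w)" if "P \<in> curve_points f" for P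
      using that z w vm by (simp add: lookup_add)
    ultimately show "D \<otimes>\<^bsub>div0_group f\<^esub> E \<in> principal_divisors f"
      unfolding principal_divisors_def div0_group_simps(2) by blast
  qed (auto simp: principal_divisors_def)
qed

section \<open>Galois action on functions, places and divisor classes\<close>

lemma degree_base_change: "degree (base_change f) = degree f"
  unfolding base_change_def by (rule degree_map_poly) simp

lemma abs_galoisD:
  assumes "\<sigma> \<in> abs_galois"
  shows "bij \<sigma>" "\<sigma> (a + b) = \<sigma> a + \<sigma> b" "\<sigma> (a * b) = \<sigma> a * \<sigma> b" "\<sigma> (to_ac q) = to_ac q"
    "\<sigma> 0 = 0" "\<sigma> a = 0 \<longleftrightarrow> a = 0"
proof -
  show *: "bij \<sigma>" "\<sigma> (a + b) = \<sigma> a + \<sigma> b" "\<sigma> (a * b) = \<sigma> a * \<sigma> b" and q: "\<sigma> (to_ac q) = to_ac q" for a b q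
    using assms by (auto simp: abs_galois_def)
  show "\<sigma> 0 = 0" using q[of 0] by simp
  then show "\<sigma> a = 0 \<longleftrightarrow> a = 0" using *(1) by (metis bij_pointE)
qed

lemma abs_galois_inv:
  assumes \<sigma>: "\<sigma> \<in> abs_galois"
  shows "inv_into UNIV \<sigma> \<in> abs_galois"
proof -
  have b: "bij \<sigma>" by (rule abs_galoisD[OF \<sigma>])
  have eq: "inv_into UNIV \<sigma> (\<sigma> a) = a" for a using b by (simp add: bij_is_inj)
  have "inv_into UNIV \<sigma> (a + b') = inv_into UNIV \<sigma> a + inv_into UNIV \<sigma> b'
      \<and> inv_into UNIV \<sigma> (a * b') = inv_into UNIV \<sigma> a * inv_into UNIV \<sigma> b'" for a b'
    using b eq abs_galoisD(2,3)[OF \<sigma>] by (metis bij_inv_eq_iff)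
  moreover have "inv_into UNIV \<sigma> (to_ac q) = to_ac q" for q
    using eq[of "to_ac q"] abs_galoisD(4)[OF \<sigma>] by simp
  ultimately show ?thesis using b by (auto simp: abs_galois_def bij_imp_bij_inv)
qed

locale galois_action =
  fixes f :: "rat poly" and \<sigma> :: "rat alg_closure \<Rightarrow> rat alg_closure"
  assumes odd: "odd (degree f)" and galois: "\<sigma> \<in> abs_galois"
begin

abbreviation "\<sigma>' \<equiv> inv_into UNIV \<sigma>"
abbreviation "F \<equiv> base_change f"
abbreviation "K \<equiv> function_field F"

lemma map_poly_base_change: "map_poly \<sigma> F = F"
  unfolding base_change_def
  by (intro poly_eqI) (simp add: coeff_map_poly abs_galoisD[OF galois])

sublocale H: curve_hom F "\<lambda>p. fun_of_poly (map_poly \<sigma> p)" "fun_y F"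
proof
  show "odd (degree F)" using odd by (simp add: degree_base_change)
  show "p = 0" if "fun_of_poly (map_poly \<sigma> p) = 0" for p
    using that by (simp add: map_poly_eq_0_iff abs_galoisD[OF galois])
qed (simp_all add: map_poly_hom_add map_poly_hom_mult abs_galoisD[OF galois] map_poly_base_change fun_y_square)

lemma galois_fun_eq: "galois_fun f \<sigma> = H.ext"
  by (simp add: fun_eq_iff galois_fun_def H.ext_def)

lemma map_poly_nonzero: "c \<noteq> 0 \<Longrightarrow> map_poly \<sigma> c \<noteq> 0"
  by (simp add: map_poly_eq_0_iff abs_galoisD[OF galois])

lemma galois_fun_frac:
  "c \<noteq> 0 \<Longrightarrow> galois_fun f \<sigma> ((fun_of_poly a + fun_of_poly b * fun_y F) / fun_of_poly c)
     = (fun_of_poly (map_poly \<sigma> a) + fun_of_poly (map_poly \<sigma> b) * fun_y F) / fun_of_poly (map_poly \<sigma> c)"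
  unfolding galois_fun_eq by (rule H.ext_eq)

lemma galois_fun_closed:
  assumes "z \<in> K" shows "galois_fun f \<sigma> z \<in> K"
proof -
  obtain a b c where c: "c \<noteq> 0" and z: "z = (fun_of_poly a + fun_of_poly b * fun_y F) / fun_of_poly c"
    using assms by (rule function_fieldE)
  show ?thesis
    unfolding z galois_fun_frac[OF c] by (rule function_fieldI[OF map_poly_nonzero[OF c]])
qed

lemma galois_action_inv: "galois_action f \<sigma>'"
  using odd galois by unfold_locales (auto intro: abs_galois_inv)

lemma galois_fun_inv:
  assumes "z \<in> K" shows "galois_fun f \<sigma>' (galois_fun f \<sigma> z) = z"
proof -
  interpret I: galois_action f \<sigma>' by (rule galois_action_inv)
  obtain a b c where c: "c \<noteq> 0" and z: "z = (fun_of_poly a + fun_of_poly b * fun_y F) / fun_of_poly c"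
    using assms by (rule function_fieldE)
  have "map_poly \<sigma>' (map_poly \<sigma> p) = p" for p
    by (intro poly_eqI) (simp add: coeff_map_poly abs_galoisD[OF galois] abs_galoisD[OF I.galois]
        bij_is_inj)
  then show ?thesis
    unfolding z galois_fun_frac[OF c] I.galois_fun_frac[OF map_poly_nonzero[OF c]] by simp
qed

lemma galois_fun_fun_of_poly: "galois_fun f \<sigma> (fun_of_poly p) = fun_of_poly (map_poly \<sigma> p)"
  by (simp add: galois_fun_eq)

lemma galois_fun_fun_y: "galois_fun f \<sigma> (fun_y F) = fun_y F"
  by (simp add: galois_fun_eq)

lemma galois_fun_diff:
  assumes "z \<in> K" "w \<in> K"
  shows "galois_fun f \<sigma> (z - w) = galois_fun f \<sigma> z - galois_fun f \<sigma> w"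
  using H.ext_add[of "z - w" w] assms by (simp add: galois_fun_eq)

lemma galois_fun_in_iff: "z \<in> K - {0} \<Longrightarrow> galois_fun f \<sigma> z \<in> K - {0}"
  using galois_fun_closed H.ext_nonzero by (auto simp: galois_fun_eq)

end

lemma (in galois_action) galois_point_closed:
  assumes v: "v \<in> curve_points F" shows "galois_point f \<sigma> v \<in> curve_points F"
proof -
  interpret I: galois_action f \<sigma>' by (rule galois_action_inv)
  interpret V: place F v by unfold_locales fact
  let ?g = "galois_fun f \<sigma>'"
  have out: "galois_point f \<sigma> v z = 0" if "z \<notin> K - {0}" for z
    using that V.v_outside[of 0] by (auto simp: galois_point_def I.galois_fun_eq I.H.ext_fun_of_poly[of 0, simplified])
  have "galois_point f \<sigma> v (z * w) = galois_point f \<sigma> v z + galois_point f \<sigma> v w"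
    "z + w \<noteq> 0 \<Longrightarrow> min (galois_point f \<sigma> v z) (galois_point f \<sigma> v w) \<le> galois_point f \<sigma> v (z + w)"
    if "z \<in> K - {0}" "w \<in> K - {0}" for z w
    using that V.v_mult[of "?g z" "?g w"] V.v_add[of "?g z" "?g w"] I.galois_fun_in_iff[of z] I.galois_fun_in_iff[of w]
      I.galois_fun_in_iff[of "z + w"]
    by (simp_all add: galois_point_def I.galois_fun_eq I.H.ext_mult I.H.ext_add)
  moreover have "galois_point f \<sigma> v (fun_const c) = 0" if "c \<noteq> 0" for c
    using that V.v_const[of "\<sigma>' c"]
    by (simp add: galois_point_def fun_const_def I.galois_fun_fun_of_poly map_poly_pCons abs_galoisD[OF I.galois])
  \<comment> \<open>The transported place evaluates through \<open>\<sigma>'\<close>, so the image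
    under \<open>\<sigma>\<close> of a uniformiser has value 1.\<close>
  moreover obtain z where z: "z \<in> K" "z \<noteq> 0" "v z = 1" by (rule V.uniformiser)
  then have "galois_fun f \<sigma> z \<in> K - {0}" "galois_point f \<sigma> v (galois_fun f \<sigma> z) = 1"
    using galois_fun_in_iff by (auto simp: galois_point_def galois_fun_inv)
  ultimately show ?thesis
    using out unfolding curve_points_def by (intro CollectI conjI) blast+
qed

lemma (in galois_action) galois_point_inv:
  assumes v: "v \<in> curve_points F" shows "galois_point f \<sigma>' (galois_point f \<sigma> v) = v"
proof
  fix z
  interpret I: galois_action f \<sigma>' by (rule galois_action_inv)
  interpret V: place F v by unfold_locales fact
  have inv: "inv_into UNIV \<sigma>' = \<sigma>" using abs_galoisD(1)[OF galois] by (rule inv_inv_eq)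
  show "galois_point f \<sigma>' (galois_point f \<sigma> v) z = v z"
    using V.v_outside by (auto simp: galois_point_def inv galois_fun_closed galois_fun_inv)
qed

lemma galois_divisor_simps:
  "galois_divisor f \<sigma> (D + E) = galois_divisor f \<sigma> D + galois_divisor f \<sigma> E"
  "galois_divisor f \<sigma> (D - E) = galois_divisor f \<sigma> D - galois_divisor f \<sigma> E"
  "galois_divisor f \<sigma> 0 = 0"
  "galois_divisor f \<sigma> (frag_of P) = frag_of (galois_point f \<sigma> P)"
  by (simp_all add: galois_divisor_def frag_extend_add frag_extend_diff)

context galois_action
begin

lemma galois_divisor_closed:
  assumes "D \<in> carrier (div0_group F)" shows "galois_divisor f \<sigma> D \<in> carrier (div0_group F)"
proof -
  have keys: "Poly_Mapping.keys D \<subseteq> curve_points F" and "divisor_degree D = 0"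
    using assms by (auto simp: div0_group_simps)
  moreover from keys have "Poly_Mapping.keys (galois_divisor f \<sigma> D) \<subseteq> curve_points F
      \<and> divisor_degree (galois_divisor f \<sigma> D) = divisor_degree D"
  proof (induction D rule: frag_induction)
    case (diff a b)
    then show ?case using keys_diff[of "galois_divisor f \<sigma> a" "galois_divisor f \<sigma> b"]
      by (auto simp: galois_divisor_simps divisor_degree_diff)
  qed (auto simp: galois_divisor_simps galois_point_closed)
  ultimately show ?thesis by (simp add: div0_group_simps)
qed

text \<open>The inverse automorphism undoes the action on places, so distinct places stay distinct
  and no multiplicities are merged.\<close>

lemma lookup_galois_divisor:
  assumes "Poly_Mapping.keys D \<subseteq> curve_points F" "P \<in> curve_points F"
  shows "Poly_Mapping.lookup (galois_divisor f \<sigma> D) (galois_point f \<sigma> P) = Poly_Mapping.lookup D P"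
  using assms(1)
proof (induction D rule: frag_induction)
  case (one Q)
  then show ?case using galois_point_inv[of Q] galois_point_inv[OF assms(2)]
    by (auto simp: galois_divisor_simps)
qed (auto simp: galois_divisor_simps lookup_minus)

lemma galois_divisor_inv:
  assumes "Poly_Mapping.keys D \<subseteq> curve_points F"
  shows "galois_divisor f \<sigma>' (galois_divisor f \<sigma> D) = D"
  using assms
  by (induction D rule: frag_induction) (auto simp: galois_divisor_simps galois_point_inv)

text \<open>The image of the divisor of \<open>z\<close> is the divisor of the conjugate function
  \<open>galois_fun f \<sigma> z\<close>.\<close>

lemma galois_divisor_principal_subset:
  "galois_divisor f \<sigma> ` principal_divisors F \<subseteq> principal_divisors F"
proof
  interpret I: galois_action f \<sigma>' by (rule galois_action_inv)
  have inv: "inv_into UNIV \<sigma>' = \<sigma>" using abs_galoisD(1)[OF galois] by (rule inv_inv_eq)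
  fix E assume "E \<in> galois_divisor f \<sigma> ` principal_divisors F"
  then obtain D z where E: "E = galois_divisor f \<sigma> D" and D: "D \<in> carrier (div0_group F)"
    and z: "z \<in> K - {0}" "\<And>P. P \<in> curve_points F \<Longrightarrow> Poly_Mapping.lookup D P = P z"
    unfolding principal_divisors_def by blast
  have "Poly_Mapping.lookup E P = P (galois_fun f \<sigma> z)" if P: "P \<in> curve_points F" for P
  proof -
    let ?Q = "galois_point f \<sigma>' P"
    have Q: "?Q \<in> curve_points F" using P by (rule I.galois_point_closed)
    have "galois_point f \<sigma> ?Q = P" using I.galois_point_inv[OF P] by (simp add: inv)
    then have "Poly_Mapping.lookup E P = Poly_Mapping.lookup D ?Q"
      using lookup_galois_divisor[OF _ Q, of D] D by (simp add: E div0_group_simps)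
    also have "\<dots> = ?Q z" using z Q by blast
    also have "\<dots> = P (galois_fun f \<sigma> z)" using z(1) by (simp add: galois_point_def inv)
    finally show ?thesis .
  qed
  then show "E \<in> principal_divisors F"
    using galois_divisor_closed[OF D] galois_fun_in_iff[OF z(1)] unfolding principal_divisors_def E by blast
qed

lemma galois_divisor_principal: "galois_divisor f \<sigma> ` principal_divisors F = principal_divisors F"
proof
  interpret I: galois_action f \<sigma>' by (rule galois_action_inv)
  have inv: "inv_into UNIV \<sigma>' = \<sigma>" using abs_galoisD(1)[OF galois] by (rule inv_inv_eq)
  show "principal_divisors F \<subseteq> galois_divisor f \<sigma> ` principal_divisors F"
  proof
    fix D assume D: "D \<in> principal_divisors F"
    then have "Poly_Mapping.keys D \<subseteq> curve_points F" by (simp add: principal_divisors_def div0_group_simps)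
    then have "D = galois_divisor f \<sigma> (galois_divisor f \<sigma>' D)"
      using I.galois_divisor_inv by (simp add: inv)
    then show "D \<in> galois_divisor f \<sigma> ` principal_divisors F"
      using I.galois_divisor_principal_subset D by blast
  qed
qed (rule galois_divisor_principal_subset)

lemma galois_divisor_coset:
  "galois_divisor f \<sigma> ` (principal_divisors F #>\<^bsub>div0_group F\<^esub> D)
     = principal_divisors F #>\<^bsub>div0_group F\<^esub> galois_divisor f \<sigma> D"
proof -
  have "galois_divisor f \<sigma> ` (principal_divisors F #>\<^bsub>div0_group F\<^esub> D)
     = (galois_divisor f \<sigma> ` principal_divisors F) #>\<^bsub>div0_group F\<^esub> galois_divisor f \<sigma> D"
    by (simp add: r_coset_def div0_group_simps galois_divisor_simps image_UN)
  then show ?thesis by (simp add: galois_divisor_principal)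
qed

end

text \<open>An invariant divisor has an invariant class, and an order that divides a prime and is
  not 1 is that prime; so nontriviality of the class is all that remains to be checked for a
  particular curve.\<close>

theorem jacobian_point_of_prime_order:
  fixes f :: "rat poly" and D :: "rat alg_closure divisor"
  assumes odd: "odd (degree f)"
    and D: "D \<in> carrier (div0_group (base_change f))"
    and inv: "\<And>\<sigma>. \<sigma> \<in> abs_galois \<Longrightarrow> galois_divisor f \<sigma> D = D"
    and np: "D \<notin> principal_divisors (base_change f)"
    and p: "Factorial_Ring.prime p" and pD: "frag_cmul (int p) D \<in> principal_divisors (base_change f)"
  shows "\<exists>A\<in>carrier (jacobian_rational_points f). group.ord (jacobian_rational_points f) A = p"
proof -
  let ?F = "base_change f"
  let ?H = "principal_divisors ?F"
  let ?J = "jacobian_rational_points f"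
  interpret odd_hyperelliptic ?F by unfold_locales (simp add: degree_base_change odd)
  interpret G: comm_group "div0_group ?F" by (rule div0_comm_group)
  have sub: "subgroup ?H (div0_group ?F)" by (rule principal_divisors_subgroup)
  then interpret N: normal ?H "div0_group ?F" by (rule G.subgroup_imp_normal)
  interpret P: group "pic0 ?F" unfolding pic0_def by (rule N.factorgroup_is_group)
  have cosets: "carrier (pic0 ?F) = {?H #>\<^bsub>div0_group ?F\<^esub> E | E. E \<in> carrier (div0_group ?F)}"
    by (auto simp: pic0_def FactGroup_def RCOSETS_def)
  have act_hom: "(\<lambda>A. galois_divisor f \<sigma> ` A) \<in> hom (pic0 ?F) (pic0 ?F)" if "\<sigma> \<in> abs_galois" for \<sigma>
  proof -
    interpret galois_action f \<sigma> using odd that by unfold_locales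
    have closed: "galois_divisor f \<sigma> ` A \<in> carrier (pic0 ?F)" if A: "A \<in> carrier (pic0 ?F)" for A
    proof -
      obtain E where E: "A = ?H #>\<^bsub>div0_group ?F\<^esub> E" "E \<in> carrier (div0_group ?F)"
        using A unfolding cosets by blast
      show ?thesis
        using galois_divisor_closed[OF E(2)] unfolding cosets E(1) galois_divisor_coset by blast
    qed
    have "galois_divisor f \<sigma> ` (A \<otimes>\<^bsub>pic0 ?F\<^esub> B)
        = galois_divisor f \<sigma> ` A \<otimes>\<^bsub>pic0 ?F\<^esub> galois_divisor f \<sigma> ` B" for A B
      by (force simp: pic0_def FactGroup_def set_mult_def div0_group_simps galois_divisor_simps)
    with closed show ?thesis by (auto simp: hom_def)
  qed
  let ?S = "{A \<in> carrier (pic0 ?F). \<forall>\<sigma>\<in>abs_galois. galois_divisor f \<sigma> ` A = A}"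
  have gh: "group_hom (pic0 ?F) (pic0 ?F) (\<lambda>A. galois_divisor f \<sigma> ` A)" if "\<sigma> \<in> abs_galois" for \<sigma>
    using act_hom[OF that] by unfold_locales
  \<comment> \<open>Each automorphism acts on the class group by a homomorphism, and common fixed
    points of homomorphisms form a subgroup.\<close>
  have "subgroup ?S (pic0 ?F)"
  proof (rule P.subgroupI)
    show "?S \<noteq> {}" using group_hom.hom_one[OF gh] by blast
  qed (use group_hom.hom_inv[OF gh] group_hom.hom_mult[OF gh] in auto)
  then interpret J: group ?J
    unfolding jacobian_rational_points_def by (rule P.subgroup_imp_group)
  define A where "A = ?H #>\<^bsub>div0_group ?F\<^esub> D"
  have A: "A \<in> carrier ?J"
  proof -
    have "galois_divisor f \<sigma> ` A = A" if "\<sigma> \<in> abs_galois" for \<sigma>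
    proof -
      interpret galois_action f \<sigma> using odd that by unfold_locales
      show ?thesis by (simp add: A_def galois_divisor_coset inv that)
    qed
    then show ?thesis using D by (auto simp: jacobian_rational_points_def cosets A_def)
  qed
  have pow: "D [^]\<^bsub>div0_group ?F\<^esub> n = frag_cmul (int n) D" for n :: nat
    by (induction n) (simp_all add: div0_group_simps frag_cmul_distrib add.commute)
  have "A [^]\<^bsub>?J\<^esub> p = A [^]\<^bsub>pic0 ?F\<^esub> p"
    unfolding jacobian_rational_points_def by (rule P.nat_pow_consistent[symmetric])
  also have "\<dots> = ?H #>\<^bsub>div0_group ?F\<^esub> (D [^]\<^bsub>div0_group ?F\<^esub> p)"
    using hom_nat_pow[OF N.r_coset_hom_Mod D G.is_group N.factorgroup_is_group, of p]
    by (simp add: A_def pic0_def)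
  also have "\<dots> = ?H"
    using pD G.nat_pow_closed[OF D] by (intro G.coset_join2 sub) (simp_all only: pow)
  also have one: "?H = \<one>\<^bsub>?J\<^esub>" by (simp add: jacobian_rational_points_def pic0_def FactGroup_def)
  finally have "J.ord A dvd p" using J.pow_eq_id[OF A] by blast
  moreover have "J.ord A \<noteq> 1"
  proof
    assume "J.ord A = 1"
    then have "A = ?H" using J.ord_eq_1[OF A] unfolding one by blast
    then have "D \<in> ?H" unfolding A_def by (rule G.coset_join1[OF _ D sub])
    with np show False by simp
  qed
  ultimately have "J.ord A = p" using p by (auto simp: prime_nat_iff)
  with A show ?thesis by blast
qed

section \<open>The quadratic invariant of a binary octic\<close>

lemma coeff_mult_top:
  fixes p q :: "'a::idom poly"
  assumes "degree p \<le> a" "degree q \<le> b"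
  shows "coeff (p * q) (a + b) = coeff p a * coeff q b"
proof (cases "degree p = a \<and> degree q = b")
  case True
  then show ?thesis using coeff_mult_degree_sum[of p q] by simp
next
  case False
  then have "degree p + degree q < a + b" using assms by linarith
  then have "degree (p * q) < a + b" using degree_mult_le[of p q] by linarith
  moreover have "coeff p a = 0 \<or> coeff q b = 0"
    using False assms by (meson coeff_eq_0 le_neq_implies_less)
  ultimately show ?thesis by (auto simp: coeff_eq_0)
qed

text \<open>The degree in the inner variable is additive over products: if \<open>a\<close> and
  \<open>b\<close> are the largest inner degrees in \<open>F\<close> and \<open>H\<close>, the parts
  of inner degree \<open>a\<close> and \<open>b\<close> multiply to the part of inner degree
  \<open>a + b\<close>, which is therefore nonzero.\<close>

lemma factor_coeff_degree_le:
  fixes F H :: "'a::idom poly poly"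
  assumes nz: "F * H \<noteq> 0" and deg: "\<And>j. degree (coeff (F * H) j) \<le> m"
  shows "degree (coeff F j) \<le> m"
proof -
  have top: "\<exists>a j. (\<forall>i. degree (coeff P i) \<le> a) \<and> degree (coeff P j) = a \<and> coeff P j \<noteq> 0" if "P \<noteq> 0"
    for P :: "'a poly poly"
  proof -
    let ?D = "(\<lambda>i. degree (coeff P i)) ` {..degree P}"
    have le: "degree (coeff P i) \<le> Max ?D" for i
      by (cases "i \<le> degree P") (auto simp: coeff_eq_0)
    have "Max ?D \<in> ?D" by (intro Max_in) auto
    then obtain j where j: "degree (coeff P j) = Max ?D" by (metis (no_types, lifting) imageE)
    \<comment> \<open>The zero polynomial has degree 0, so the maximum may be attained at a
      vanishing coefficient; then all coefficients are constants and the leading one serves.\<close>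
    show ?thesis
    proof (cases "coeff P j = 0")
      case True
      then have "Max ?D = 0" using j by simp
      moreover have "coeff P (degree P) \<noteq> 0" using that by simp
      ultimately show ?thesis using le by (metis le_zero_eq)
    next
      case False
      then show ?thesis using le j by metis
    qed
  qed
  obtain a i where a: "\<And>i. degree (coeff F i) \<le> a" "degree (coeff F i) = a" "coeff F i \<noteq> 0"
    using top[of F] nz by auto
  obtain b k where b: "\<And>k. degree (coeff H k) \<le> b" "degree (coeff H k) = b" "coeff H k \<noteq> 0"
    using top[of H] nz by auto
  let ?F = "map_poly (\<lambda>c. coeff c a) F" and ?H = "map_poly (\<lambda>c. coeff c b) H"
  have "coeff ?F i \<noteq> 0" "coeff ?H k \<noteq> 0"
    using a(2,3) b(2,3) by (auto simp: coeff_map_poly)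
  then have "?F * ?H \<noteq> 0" by fastforce
  moreover have "map_poly (\<lambda>c. coeff c (a + b)) (F * H) = ?F * ?H"
    by (intro poly_eqI) (simp add: coeff_map_poly coeff_mult[of F H] coeff_mult[of ?F ?H] coeff_sum coeff_mult_top a(1) b(1))
  ultimately have "map_poly (\<lambda>c. coeff c (a + b)) (F * H) \<noteq> 0" by (simp only: simp_thms)
  then have "lead_coeff (map_poly (\<lambda>c. coeff c (a + b)) (F * H)) \<noteq> 0" by (simp only: leading_coeff_0_iff simp_thms not_False_eq_True)
  then obtain l where "coeff (coeff (F * H) l) (a + b) \<noteq> 0"
    by (simp only: coeff_map_poly coeff_0)
  then have "a + b \<le> m" using deg[of l] le_degree order_trans by blast
  then show ?thesis using a(1)[of j] by linarith
qed

lemma Fract_1_eq_to_fract: "Fract p 1 = to_fract p"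
  by (simp add: to_fract_def)

lemma fract_coprimeE:
  fixes r :: "rat poly fract"
  obtains n d where "d \<noteq> 0" "coprime n d" "r = to_fract n / to_fract d"
proof -
  obtain n d where r: "r = Fract n d" "d \<noteq> 0" by (cases r)
  obtain n' d' where nd: "n = n' * gcd n d" "d = d' * gcd n d" "coprime n' d'"
    using gcd_coprime_exists[of n d] r(2) by (metis gcd_eq_0_iff)
  have "r = Fract n' d'" using r nd
    by (metis eq_fract(1) mult.assoc mult.commute mult_eq_0_iff)
  moreover have "d' \<noteq> 0" using r(2) nd(2) by auto
  ultimately show ?thesis using that nd(3) by (simp add: to_fract_def)
qed

text \<open>If \<open>d\<close> is the reduced denominator of \<open>t\<close>, then
  \<open>d\<^sup>2\<close> divides the squarefree \<open>h\<close>, so \<open>d\<close> is a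
  unit.\<close>

lemma square_times_squarefree:
  fixes h :: "rat poly"
  assumes sf: "squarefree h" and eq: "to_fract p = t\<^sup>2 * to_fract h"
  obtains q where "p = q\<^sup>2 * h"
proof -
  obtain n d where d: "d \<noteq> 0" "coprime n d" "t = to_fract n / to_fract d" by (rule fract_coprimeE)
  have "to_fract (d\<^sup>2 * p) = to_fract (n\<^sup>2 * h)"
    using d(1) eq by (simp add: d(3) power_divide to_fract_mult power2_eq_square field_simps)
  then have e: "d\<^sup>2 * p = n\<^sup>2 * h" by (simp only: to_fract_eq_iff)
  then have "d\<^sup>2 dvd n\<^sup>2 * h" by (metis dvd_triv_left)
  moreover have "coprime (d\<^sup>2) (n\<^sup>2)" using d(2) by (simp add: coprime_commute)
  ultimately have "d\<^sup>2 dvd h" by (simp only: coprime_dvd_mult_right_iff)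
  then have "d dvd 1" using sf by (auto simp: squarefree_def)
  then obtain k where k: "d * k = 1" by (auto elim: dvdE)
  have "p = (d * k)\<^sup>2 * p" by (simp add: k)
  also have "\<dots> = k\<^sup>2 * (d\<^sup>2 * p)" by (simp add: power_mult_distrib algebra_simps)
  also have "\<dots> = (k * n)\<^sup>2 * h" unfolding e by (simp add: power_mult_distrib algebra_simps)
  finally show ?thesis using that by blast
qed

definition lift_const :: "rat poly \<Rightarrow> rat poly poly" where
  "lift_const p = map_poly (\<lambda>c. [:c:]) p"

text \<open>Relations between \<open>x\<close> and \<open>U\<close>: the inner variable is read as
  \<open>x\<close> and the outer one as \<open>U\<close>; \<open>lift_const p\<close> puts
  \<open>p\<close> into the outer variable.\<close>

definition ev :: "rat poly fract alg_closure \<Rightarrow> rat poly poly \<Rightarrow> rat poly fract alg_closure" where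
  "ev U G = poly (map_poly fun_of_poly G) U"

lemma ev_add: "ev U (G + H) = ev U G + ev U H"
  by (simp add: ev_def map_poly_hom_add)

lemma ev_smult: "ev U (smult a G) = fun_of_poly a * ev U G"
  by (simp add: ev_def map_poly_smult)

lemma fun_const_0 [simp]: "fun_const 0 = 0"
  by (simp add: fun_const_def)

lemma ev_lift_const: "ev U (lift_const p) = poly (map_poly fun_const p) U"
  unfolding ev_def lift_const_def
  by (subst map_poly_map_poly) (auto simp: o_def fun_const_def[abs_def])

lemma ev_fract: "ev U G = poly (map_poly to_ac (fract_poly G)) U"
  unfolding ev_def
  by (subst map_poly_map_poly) (auto simp: o_def fun_of_poly_def[abs_def] Fract_1_eq_to_fract)

lemma ev_base: "ev (to_ac r) G = to_ac (poly (fract_poly G) r)"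
  unfolding ev_fract by (induction G) (simp_all add: map_poly_pCons)

text \<open>This is \<open>140\<close> times the classical invariant \<open>\<Sum>i\<le>8. (-1)\<^sup>i a\<^sub>i a\<^sub>8\<^sub>-\<^sub>i / (8 choose i)\<close>. A polynomial
  of degree \<open>7\<close> is an octic with a root at infinity.\<close>

definition octic_invariant :: "rat poly \<Rightarrow> rat" where
  "octic_invariant p = 280 * coeff p 0 * coeff p 8 - 35 * coeff p 1 * coeff p 7 + 10 * coeff p 2 * coeff p 6
     - 5 * coeff p 3 * coeff p 5 + 2 * (coeff p 4)\<^sup>2"

section \<open>Moebius substitutions on binary octics\<close>

definition homog8 :: "rat poly \<Rightarrow> rat poly \<Rightarrow> rat poly \<Rightarrow> rat poly" where
  "homog8 p n d = (\<Sum>i\<le>8. smult (coeff p i) (n ^ i * d ^ (8 - i)))"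

lemma poly_degree_le_8:
  assumes "degree (p :: rat poly) \<le> 8"
  shows "p = [:coeff p 0, coeff p 1, coeff p 2, coeff p 3, coeff p 4, coeff p 5, coeff p 6, coeff p 7, coeff p 8:]"
proof (rule poly_eqI)
  fix n :: nat
  consider "n = 0 \<or> n = 1 \<or> n = 2 \<or> n = 3 \<or> n = 4 \<or> n = 5 \<or> n = 6 \<or> n = 7 \<or> n = 8"
    | k where "n = k + 9"
    using le_Suc_ex[of 9 n] by (cases "n \<ge> 9") (fastforce, arith)
  then show "coeff p n = coeff [:coeff p 0, coeff p 1, coeff p 2, coeff p 3, coeff p 4, coeff p 5, coeff p 6, coeff p 7, coeff p 8:] n"
  proof cases
    case 2
    then show ?thesis using assms by (simp add: coeff_eq_0 coeff_pCons numeral_eq_Suc split: nat.split)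
  qed (auto simp: coeff_pCons numeral_eq_Suc)
qed

lemma octic_invariant_coeffs:
  "octic_invariant [:a0, a1, a2, a3, a4, a5, a6, a7, a8:]
     = 280 * a0 * a8 - 35 * a1 * a7 + 10 * a2 * a6 - 5 * a3 * a5 + 2 * a4\<^sup>2"
  by (simp add: octic_invariant_def coeff_pCons numeral_eq_Suc)

lemma octic_invariant_smult: "octic_invariant (smult c p) = c\<^sup>2 * octic_invariant p"
  by (simp add: octic_invariant_def power2_eq_square algebra_simps)

lemma octic_invariant_translate:
  assumes "degree p \<le> 8" shows "octic_invariant (pcompose p [:b, 1:]) = octic_invariant p"
proof -
  obtain a0 a1 a2 a3 a4 a5 a6 a7 a8 where p: "p = [:a0, a1, a2, a3, a4, a5, a6, a7, a8:]"
    using poly_degree_le_8[OF assms] by blast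
  \<comment> \<open>The entries are the Taylor coefficients of \<open>p\<close> at \<open>b\<close>;
    the claim becomes a polynomial identity in \<open>b\<close> and the nine coefficients.\<close>
  have "pcompose p [:b, 1:] = [:
     a0 + a1*b + a2*b^2 + a3*b^3 + a4*b^4 + a5*b^5 + a6*b^6 + a7*b^7 + a8*b^8,
     a1 + 2*a2*b + 3*a3*b^2 + 4*a4*b^3 + 5*a5*b^4 + 6*a6*b^5 + 7*a7*b^6 + 8*a8*b^7,
     a2 + 3*a3*b + 6*a4*b^2 + 10*a5*b^3 + 15*a6*b^4 + 21*a7*b^5 + 28*a8*b^6,
     a3 + 4*a4*b + 10*a5*b^2 + 20*a6*b^3 + 35*a7*b^4 + 56*a8*b^5,
     a4 + 5*a5*b + 15*a6*b^2 + 35*a7*b^3 + 70*a8*b^4,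
     a5 + 6*a6*b + 21*a7*b^2 + 56*a8*b^3,
     a6 + 7*a7*b + 28*a8*b^2,
     a7 + 8*a8*b, a8:]"
    by (simp add: p pcompose_pCons) (simp add: algebra_simps eval_nat_numeral)
  then show ?thesis
    unfolding p octic_invariant_coeffs by (simp only: octic_invariant_coeffs) (simp add: algebra_simps power_numeral_reduce)
qed

lemma coeff_pcompose_scale: "coeff (pcompose p [:0, a:]) n = coeff p n * a ^ n" for p :: "rat poly"
  by (induction p arbitrary: n) (auto simp: pcompose_pCons coeff_pCons split: nat.split)

lemma octic_invariant_scale: "octic_invariant (pcompose p [:0, a:]) = a ^ 8 * octic_invariant p"
  by (simp add: octic_invariant_def coeff_pcompose_scale algebra_simps power_numeral_reduce poly_0_coeff_0)

lemma octic_invariant_affine: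
  assumes "degree p \<le> 8" shows "octic_invariant (pcompose p [:b, a:]) = a ^ 8 * octic_invariant p"
proof -
  have "pcompose p [:b, a:] = pcompose (pcompose p [:b, 1:]) [:0, a:]"
  proof -
    have "pcompose [:b, 1:] [:0, a:] = [:b, a:]" by (simp add: pcompose_pCons)
    then show ?thesis by (metis pcompose_assoc)
  qed
  then show ?thesis using assms by (simp add: octic_invariant_scale octic_invariant_translate)
qed

lemma poly_sum_le_8:
  assumes "degree (p :: rat poly) \<le> 8"
  shows "poly p x = (\<Sum>i\<le>8. coeff p i * x ^ i)"
  unfolding poly_altdef
  using assms by (intro sum.mono_neutral_left) (auto simp: coeff_eq_0)

lemma poly_homog8: "poly (homog8 p n d) x = (\<Sum>i\<le>8. coeff p i * (poly n x ^ i * poly d x ^ (8 - i)))"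
  by (simp add: homog8_def poly_sum)

lemma poly_homog8_nz:
  assumes "degree p \<le> 8" "poly d x \<noteq> 0"
  shows "poly (homog8 p n d) x = poly d x ^ 8 * poly p (poly n x / poly d x)"
  unfolding poly_homog8 poly_sum_le_8[OF assms(1)] sum_distrib_left
proof (intro sum.cong refl)
  fix i :: nat assume "i \<in> {..8}"
  then have "poly d x ^ 8 = poly d x ^ i * poly d x ^ (8 - i)" by (simp flip: power_add)
  then show "coeff p i * (poly n x ^ i * poly d x ^ (8 - i)) = poly d x ^ 8 * (coeff p i * (poly n x / poly d x) ^ i)"
    using assms(2) by (simp add: power_divide)
qed

text \<open>For \<open>c = 0\<close> the substitution is affine. Otherwise
  \<open>(a x + b) / (c x + d)\<close> equals \<open>a / c + e / (c x + d)\<close>: an affine map,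
  an inversion and an affine map. The inversion reverses the nine coefficients, under which the
  invariant is symmetric, and \<open>c * e\<close> is the determinant up to sign.\<close>

lemma octic_invariant_homog8:
  assumes p: "degree p \<le> 8" and nz: "[:d, c:] \<noteq> 0"
  shows "octic_invariant (homog8 p [:b, a:] [:d, c:]) = (a * d - b * c) ^ 8 * octic_invariant p"
proof (cases "c = 0")
  case True
  then have "d \<noteq> 0" using nz by simp
  have "homog8 p [:b, a:] [:d, c:] = smult (d ^ 8) (pcompose p [:b / d, a / d:])"
  proof (rule iffD1[OF poly_eq_poly_eq_iff], rule ext)
    fix x
    show "poly (homog8 p [:b, a:] [:d, c:]) x = poly (smult (d ^ 8) (pcompose p [:b / d, a / d:])) x"
      using \<open>d \<noteq> 0\<close> True by (subst poly_homog8_nz[OF p]) (auto simp: poly_pcompose add_divide_distrib)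
  qed
  then have "octic_invariant (homog8 p [:b, a:] [:d, c:]) = (d ^ 8)\<^sup>2 * ((a / d) ^ 8 * octic_invariant p)"
    using p by (simp add: octic_invariant_smult octic_invariant_affine)
  also have "\<dots> = d ^ 8 * ((d * (a / d)) ^ 8 * octic_invariant p)"
    by (simp only: power2_eq_square power_mult_distrib mult_ac)
  finally show ?thesis using True \<open>d \<noteq> 0\<close> by (simp add: power_mult_distrib)
next
  case False
  define e where "e = b - a * d / c"
  define q where "q = pcompose p [:a / c, e:]"
  define q' where "q' = (\<Sum>i\<le>8. monom (coeff q (8 - i)) i)"
  have coeff_q': "coeff q' i = (if i \<le> 8 then coeff q (8 - i) else 0)" for i
    by (simp add: q'_def coeff_sum if_distrib cong: if_cong)
  have deg_q: "degree q \<le> 8"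
  proof -
    have "degree q \<le> degree p * degree [:a / c, e:]" unfolding q_def by (rule degree_pcompose_le)
    also have "\<dots> \<le> 8 * 1" using p by (intro mult_le_mono) auto
    finally show ?thesis by simp
  qed
  have deg_q': "degree q' \<le> 8" by (intro degree_le) (simp add: coeff_q')
  have "octic_invariant q' = octic_invariant q" by (simp add: octic_invariant_def coeff_q' algebra_simps)
  \<comment> \<open>The factor \<open>d + c x\<close> makes both sides vanish at the pole of the
    substitution, where the quotient cannot be evaluated; it is cancelled afterwards.\<close>
  have "[:d, c:] * homog8 p [:b, a:] [:d, c:] = [:d, c:] * pcompose q' [:d, c:]"
  proof (rule iffD1[OF poly_eq_poly_eq_iff], rule ext)
    fix x
    let ?L = "d + c * x"
    show "poly ([:d, c:] * homog8 p [:b, a:] [:d, c:]) x = poly ([:d, c:] * pcompose q' [:d, c:]) x"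
    proof (cases "?L = 0")
      case True
      then have "poly [:d, c:] x = 0" by (simp add: mult.commute)
      then show ?thesis by (simp only: poly_mult mult_zero_left)
    next
      case L: False
      have "poly q' ?L = (\<Sum>i\<le>8. coeff q (8 - i) * ?L ^ i)"
        unfolding poly_sum_le_8[OF deg_q'] by (intro sum.cong) (auto simp: coeff_q')
      also have "\<dots> = (\<Sum>i\<le>8. coeff q i * ?L ^ (8 - i))"
        by (intro sum.reindex_bij_witness[of _ "\<lambda>i. 8 - i" "\<lambda>i. 8 - i"]) auto
      also have "\<dots> = (\<Sum>i\<le>8. coeff q i * (1 ^ i * ?L ^ (8 - i)))" by simp
      also have "\<dots> = ?L ^ 8 * poly q (1 / ?L)"
        using poly_homog8_nz[OF deg_q, of "[:d, c:]" x "[:1:]"] L poly_homog8[of q "[:1:]" "[:d, c:]" x]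
        by (simp add: mult.commute)
      also have "poly q (1 / ?L) = poly p ((b + a * x) / ?L)"
      proof -
        have "b + a * x = a / c * ?L + e" using False by (simp add: e_def field_simps)
        then have "a / c + 1 / ?L * e = (b + a * x) / ?L"
          using L by (simp add: add_divide_distrib)
        then show ?thesis by (simp add: q_def poly_pcompose)
      qed
      also have "?L ^ 8 * \<dots> = poly (homog8 p [:b, a:] [:d, c:]) x"
        using L by (subst poly_homog8_nz[OF p]) (auto simp: mult.commute)
      finally show ?thesis by (simp add: poly_pcompose mult.commute)
    qed
  qed
  then have "homog8 p [:b, a:] [:d, c:] = pcompose q' [:d, c:]" using nz mult_left_cancel by blast
  then have "octic_invariant (homog8 p [:b, a:] [:d, c:]) = c ^ 8 * (e ^ 8 * octic_invariant p)"
    using octic_invariant_affine[OF deg_q'] octic_invariant_affine[OF p] \<open>octic_invariant q' = octic_invariant q\<close> by (simp add: q_def)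
  also have "\<dots> = (c * e) ^ 8 * octic_invariant p" by (simp add: power_mult_distrib)
  also have "c * e = - (a * d - b * c)" using False by (simp add: e_def field_simps)
  also have "(- (a * d - b * c)) ^ 8 = (a * d - b * c) ^ 8" by (subst uminus_power_if) simp
  finally show ?thesis .
qed

section \<open>Isomorphisms of hyperelliptic curves\<close>

lemma poly_degree_le_1: "degree p \<le> 1 \<Longrightarrow> p = [:coeff p 0, coeff p 1:]"
  by (rule poly_eqI) (auto simp: coeff_pCons coeff_eq_0 split: nat.split)

lemma (in odd_hyperelliptic) independent_fract:
  assumes "to_ac a + to_ac b * fun_y f = 0" shows "a = 0" "b = 0"
proof -
  obtain p q where a: "a = Fract p q" "q \<noteq> 0" by (cases a)
  obtain r s where b: "b = Fract r s" "s \<noteq> 0" by (cases b)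
  have frac: "to_ac (Fract p q) * fun_of_poly q = fun_of_poly p" if "q \<noteq> 0" for p q :: "'k poly"
    unfolding fun_of_poly_def to_ac_mult[symmetric] using that by (simp add: eq_fract)
  have "(to_ac a * fun_of_poly q) * fun_of_poly s + (to_ac b * fun_of_poly s) * fun_of_poly q * fun_y f
      = (to_ac a + to_ac b * fun_y f) * (fun_of_poly q * fun_of_poly s)"
    by (simp add: algebra_simps)
  then have "fun_of_poly (p * s) + fun_of_poly (r * q) * fun_y f = 0"
    unfolding a(1) b(1) frac[OF a(2)] frac[OF b(2)] using assms by (simp add: a(1) b(1))
  then have "p * s = 0" "r * q = 0" by (simp_all only: independent_iff)
  then show "a = 0" "b = 0" using a b by (auto simp: Zero_fract_def eq_fract)
qed

text \<open>Coprimality makes \<open>d T - n\<close> primitive, so by Gauss's lemma divisibility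
  over the fraction field descends to polynomials.\<close>

lemma ev_linear_dvd:
  assumes d: "d \<noteq> 0" "coprime n d" and ev: "ev (to_ac (to_fract n / to_fract d)) G = 0"
  shows "[:- n, d:] dvd G"
proof (rule fract_poly_dvdD)
  let ?r = "to_fract n / to_fract d"
  have "poly (fract_poly G) ?r = 0" using ev unfolding ev_base to_ac_eq_0_iff .
  then have "[:- ?r, 1:] dvd fract_poly G" by (simp add: poly_eq_0_iff_dvd)
  moreover have "fract_poly [:- n, d:] = smult (to_fract d) [:- ?r, 1:]"
    using d by (simp add: map_poly_pCons)
  ultimately show "fract_poly [:- n, d:] dvd fract_poly G"
    using d(1) smult_dvd by (metis to_fract_eq_0_iff)
  have "coprime (- n) d" using d(2) by simp
  then have "gcd (- n) d = 1" by (simp only: coprime_iff_gcd_eq_1)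
  then show "content [:- n, d:] = 1" by (simp add: content_def cCons_def d)
qed

text \<open>The divisor is \<open>(T - r)\<^sup>2 - s\<^sup>2 f\<close>, with roots
  \<open>r + s y\<close> and \<open>r - s y\<close>. The remainder has degree at most 1 and the root
  \<open>r + s y\<close>, so for nonzero \<open>s\<close> it vanishes by independence of 1 and
  \<open>y\<close>.\<close>

lemma (in odd_hyperelliptic) quadratic_dvd:
  fixes P :: "'k poly fract poly"
  assumes s: "s \<noteq> 0" and root: "poly (map_poly to_ac P) (to_ac r + to_ac s * fun_y f) = 0"
  shows "[:r\<^sup>2 - s\<^sup>2 * to_fract f, - 2 * r, 1:] dvd P"
proof -
  let ?m = "[:r\<^sup>2 - s\<^sup>2 * to_fract f, - 2 * r, 1:]"
  let ?U = "to_ac r + to_ac s * fun_y f"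
  have "degree (P mod ?m) < 2 \<or> P mod ?m = 0"
    using degree_mod_less[of ?m P] by auto
  then have "degree (P mod ?m) \<le> 1" by auto
  then obtain c0 c1 where c: "P mod ?m = [:c0, c1:]"
    using poly_degree_le_1 by blast
  have y2: "fun_y f * fun_y f = to_ac (to_fract f)"
    using fun_y_square[of f] by (simp add: fun_of_poly_def Fract_1_eq_to_fract power2_eq_square)
  have m: "poly (map_poly to_ac ?m) ?U = 0"
    by (simp add: map_poly_pCons algebra_simps power2_eq_square y2)
  have "map_poly to_ac P = map_poly to_ac ?m * map_poly to_ac (P div ?m) + map_poly to_ac (P mod ?m)"
    by (simp only: map_poly_hom_add[OF to_ac_0 to_ac_add, symmetric]
        map_poly_hom_mult[OF to_ac_0 to_ac_add to_ac_mult, symmetric] mult_div_mod_eq)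
  then have "poly (map_poly to_ac [:c0, c1:]) ?U = 0"
    using root m c by (simp only: poly_add poly_mult mult_zero_left add_0)
  then have "to_ac (c0 + c1 * r) + to_ac (c1 * s) * fun_y f = 0"
    by (simp add: map_poly_pCons algebra_simps)
  from independent_fract[OF this] have "c0 = 0" "c1 = 0" using s by auto
  then show ?thesis using c by (simp add: dvd_eq_mod_eq_0)
qed

text \<open>For nonzero \<open>s\<close>, the primitive polynomial \<open>F\<close> proportional to
  the minimal polynomial of \<open>U\<close> divides \<open>G\<close> by Gauss's lemma and inherits
  the bound 2 on inner degrees. Its discriminant is \<open>(2 s / k)\<^sup>2 h\<close>, and by
  squarefreeness a polynomial square times \<open>h\<close>: degree at least 7 against at most
  4.\<close>

lemma no_quadratic_relation:
  fixes h :: "rat poly"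
  assumes h: "degree h = 7" "squarefree h"
    and G: "G \<noteq> 0" "\<And>j. degree (coeff G j) \<le> 2"
    and U: "U = to_ac r + to_ac s * fun_y h" "ev U G = 0"
  shows "s = 0"
proof (rule ccontr)
  assume s: "s \<noteq> 0"
  interpret odd_hyperelliptic h by unfold_locales (simp add: h)
  let ?m = "[:r\<^sup>2 - s\<^sup>2 * to_fract h, - 2 * r, 1:]"
  have "?m dvd fract_poly G"
    using s U(2) unfolding U(1) ev_fract by (rule quadratic_dvd)
  moreover obtain k F where F: "?m = smult k (fract_poly F)" "content F = 1"
    using content_decompose_fract[of ?m] by auto
  moreover have "k \<noteq> 0" using F(1) by auto
  ultimately have "F dvd G"
    by (intro fract_poly_dvdD) (auto simp: smult_dvd_iff)
  then obtain H where H: "G = F * H" by (elim dvdE)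
  have deg: "degree (coeff F j) \<le> 2" for j
    using factor_coeff_degree_le[of F H 2] G unfolding H by blast
  have "coeff ?m j = k * to_fract (coeff F j)" for j
    unfolding F(1) by (simp add: coeff_map_poly)
  from this[of 0] this[of 1] this[of 2]
  have e: "r\<^sup>2 - s\<^sup>2 * to_fract h = k * to_fract (coeff F 0)" "- 2 * r = k * to_fract (coeff F 1)"
    "1 = k * to_fract (coeff F 2)"
    by (simp_all add: numeral_2_eq_2)
  define \<Delta> where "\<Delta> = (coeff F 1)\<^sup>2 - 4 * coeff F 0 * coeff F 2"
  have four: "to_fract (4 :: rat poly) = 4"
    using to_fract_add[of 2 "2 :: rat poly"] to_fract_add[of 1 "1 :: rat poly"] by simp
  have "k\<^sup>2 * to_fract \<Delta> = (k * to_fract (coeff F 1))\<^sup>2 - 4 * (k * to_fract (coeff F 0)) * (k * to_fract (coeff F 2))"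
    by (simp add: \<Delta>_def power2_eq_square algebra_simps four)
  also have "\<dots> = 4 * s\<^sup>2 * to_fract h"
    unfolding e[symmetric] by (simp add: power2_eq_square algebra_simps)
  finally have "to_fract \<Delta> = (2 * s / k)\<^sup>2 * to_fract h"
    using \<open>k \<noteq> 0\<close> by (simp add: power2_eq_square field_simps)
  then obtain q where q: "\<Delta> = q\<^sup>2 * h" using square_times_squarefree[OF h(2)] by blast
  have "\<Delta> \<noteq> 0"
  proof
    assume "\<Delta> = 0"
    then have "(2 * s / k)\<^sup>2 * to_fract h = 0" using \<open>to_fract \<Delta> = _\<close> by simp
    moreover have "(2 :: rat poly fract) \<noteq> 0" using four by (metis mult_zero_left to_fract_eq_0_iff zero_neq_numeral numeral_Bit0_eq_double)
    ultimately show False using s \<open>k \<noteq> 0\<close> f_nonzero by simp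
  qed
  then have "q \<noteq> 0" using q by auto
  then have "7 \<le> degree \<Delta>" using f_nonzero h(1) by (simp add: q degree_mult_eq power2_eq_square)
  moreover have "degree \<Delta> \<le> 4"
  proof -
    have "degree ((coeff F 1)\<^sup>2) \<le> 4"
      using degree_mult_le[of "coeff F 1" "coeff F 1"] deg[of 1] by (simp add: power2_eq_square)
    moreover have "degree (4 * coeff F 0 * coeff F 2) \<le> 4"
    proof -
      have "4 * coeff F 0 * coeff F 2 = smult 4 (coeff F 0 * coeff F 2)"
        by (simp add: numeral_poly)
      then show ?thesis using degree_mult_le[of "coeff F 0" "coeff F 2"] deg[of 0] deg[of 2] by simp
    qed
    ultimately show ?thesis unfolding \<Delta>_def by (rule degree_diff_le)
  qed
  ultimately show False by simp
qed

lemma ev_homog8: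
  fixes f n d :: "rat poly"
  assumes "degree f \<le> 8" "d \<noteq> 0"
  shows "to_fract (homog8 f n d) = to_fract d ^ 8 * poly (map_poly (\<lambda>c. to_fract [:c:]) f) (to_fract n / to_fract d)"
proof -
  have pow: "to_fract (p ^ i) = to_fract p ^ i" for p :: "rat poly" and i
    by (induction i) auto
  have sm: "to_fract (smult c p) = to_fract [:c:] * to_fract p" for c and p :: "rat poly"
    by (simp flip: to_fract_mult)
  have deg: "degree (map_poly (\<lambda>c. to_fract [:c:]) f) = degree f"
    by (subst degree_map_poly) auto
  have "poly (map_poly (\<lambda>c. to_fract [:c:]) f) (to_fract n / to_fract d)
      = (\<Sum>i\<le>8. to_fract [:coeff f i:] * (to_fract n / to_fract d) ^ i)"
    unfolding poly_altdef deg using assms(1)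
    by (intro sum.mono_neutral_cong_left) (auto simp: coeff_map_poly coeff_eq_0)
  also have "to_fract d ^ 8 * \<dots> = (\<Sum>i\<le>8. to_fract [:coeff f i:] * (to_fract n ^ i * to_fract d ^ (8 - i)))"
    unfolding sum_distrib_left
  proof (intro sum.cong refl)
    fix i :: nat assume "i \<in> {..8}"
    then have "to_fract d ^ 8 = to_fract d ^ i * to_fract d ^ (8 - i)" by (simp flip: power_add)
    then show "to_fract d ^ 8 * (to_fract [:coeff f i:] * (to_fract n / to_fract d) ^ i)
        = to_fract [:coeff f i:] * (to_fract n ^ i * to_fract d ^ (8 - i))"
      using assms(2) by (simp add: power_divide)
  qed
  also have "\<dots> = to_fract (homog8 f n d)"
    by (simp only: homog8_def to_fract_sum sm pow to_fract_mult)
  finally show ?thesis by simp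
qed

theorem curve_isomorphic_invariant:
  fixes f h :: "rat poly"
  assumes iso: "curve_isomorphic f h" and df: "degree f = 7" and dh: "degree h = 7" and sf: "squarefree h"
  shows "\<exists>\<rho>. octic_invariant h = \<rho> ^ 4 * octic_invariant f"
proof -
  interpret f: odd_hyperelliptic f by unfold_locales (simp add: df)
  interpret h: odd_hyperelliptic h by unfold_locales (simp add: dh)
  let ?K = "function_field f" and ?L = "function_field h"
  let ?x = "fun_of_poly [:0, 1 :: rat:]"
  obtain \<phi> where bij: "bij_betw \<phi> ?K ?L"
    and add: "\<And>u w. u \<in> ?K \<Longrightarrow> w \<in> ?K \<Longrightarrow> \<phi> (u + w) = \<phi> u + \<phi> w"
    and mult: "\<And>u w. u \<in> ?K \<Longrightarrow> w \<in> ?K \<Longrightarrow> \<phi> (u * w) = \<phi> u * \<phi> w"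
    and const: "\<And>c. \<phi> (fun_const c) = fun_const c"
    using iso unfolding curve_isomorphic_def by blast
  define U where "U = \<phi> ?x"
  define W where "W = \<phi> (fun_y f)"
  define pu where "pu p = poly (map_poly fun_const p) U" for p
  have inj: "\<phi> u = \<phi> w \<Longrightarrow> u = w" if "u \<in> ?K" "w \<in> ?K" for u w
    using bij that by (auto simp: bij_betw_def inj_on_def)
  have phi0: "\<phi> 0 = 0" using const[of 0] by simp
  have phi_poly: "\<phi> (fun_of_poly p) = pu p" for p
  proof (induction p)
    case (pCons a p)
    have "fun_of_poly (pCons a p) = fun_const a + ?x * fun_of_poly p"
      by (simp add: fun_const_def flip: fun_of_poly_mult fun_of_poly_add)
    then have "\<phi> (fun_of_poly (pCons a p)) = fun_const a + U * pu p"
      using add[of "fun_const a" "?x * fun_of_poly p"] mult[of ?x "fun_of_poly p"] pCons const[of a]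
      by (simp add: U_def fun_const_def)
    then show ?case by (simp add: pu_def map_poly_pCons)
  qed (simp add: phi0 pu_def)
  have W2: "W\<^sup>2 = pu f"
    using mult[of "fun_y f" "fun_y f"] phi_poly[of f] by (simp add: W_def power2_eq_square flip: fun_y_square[of f])
  have "U \<in> ?L" "W \<in> ?L" using bij by (auto simp: U_def W_def bij_betw_def)
  then obtain r s r' s' where U: "U = to_ac r + to_ac s * fun_y h" and W: "W = to_ac r' + to_ac s' * fun_y h"
    unfolding function_field_def by blast
  \<comment> \<open>Surjectivity of \<open>\<phi>\<close> made explicit: each target element is a
    fraction in \<open>U\<close> and \<open>W\<close>. Applied to \<open>x\<close> it bounds degrees
    in \<open>x\<close>; applied to \<open>y\<close> it shows that \<open>W\<close> involves
    \<open>y\<close>.\<close>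
  have img: "\<exists>A B C. pu C \<noteq> 0 \<and> w * pu C = pu A + pu B * W" if w: "w \<in> ?L" for w
  proof -
    have "w \<in> \<phi> ` ?K" using bij_betw_imp_surj_on[OF bij] w by (simp only:)
    then obtain z where z: "\<phi> z = w" "z \<in> ?K" by (metis imageE)
    obtain A B C where C: "C \<noteq> 0" and zz: "z = (fun_of_poly A + fun_of_poly B * fun_y f) / fun_of_poly C"
      using z(2) by (rule function_fieldE)
    have "z * fun_of_poly C = fun_of_poly A + fun_of_poly B * fun_y f" using C by (simp add: zz)
    then have "\<phi> z * \<phi> (fun_of_poly C) = \<phi> (fun_of_poly A) + \<phi> (fun_of_poly B) * \<phi> (fun_y f)"
      using z(2) by (metis add mult fun_of_poly_in_function_field fun_y_in_function_field function_field_mult)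
    moreover have "\<phi> (fun_of_poly C) \<noteq> 0"
      using inj[of "fun_of_poly C" 0] C phi0 by auto
    ultimately show ?thesis unfolding phi_poly z(1) W_def[symmetric] by blast
  qed
  have pu_ev: "ev U (lift_const p) = pu p" for p by (simp add: ev_lift_const pu_def)
  have pu_nz: "C \<noteq> 0" if "pu C \<noteq> 0" for C using that by (auto simp: pu_def)
  have pu_add: "pu (p + q) = pu p + pu q" and pu_mult: "pu (p * q) = pu p * pu q" for p q
    by (simp_all flip: phi_poly add: add mult)
  obtain A B C where C: "pu C \<noteq> 0" and x: "?x * pu C = pu A + pu B * W"
    using img[of ?x] by auto

  have s: "s = 0"
  proof -
    \<comment> \<open>Squaring \<open>x C(U) - A(U) = B(U) W\<close> and replacing
      \<open>W\<^sup>2\<close> by \<open>f(U)\<close> eliminates \<open>W\<close>; the result has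
      degree 2 in \<open>x\<close>.\<close>
    define G where "G = smult [:0, 0, 1:] (lift_const (C * C)) + smult [:0, - 2:] (lift_const (A * C))
        + lift_const (A * A - B * B * f)"
    have cG: "coeff G j = [:coeff (A * A - B * B * f) j, - 2 * coeff (A * C) j, coeff (C * C) j:]" for j
      by (simp add: G_def lift_const_def coeff_map_poly)
    have "coeff G (degree (C * C)) \<noteq> 0"
      unfolding cG using pu_nz[OF C] by simp
    then have "G \<noteq> 0" by auto
    moreover have "degree (coeff G j) \<le> 2" for j
      unfolding cG by (intro degree_le) (auto simp: coeff_pCons split: nat.split)
    moreover have "ev U G = 0"
    proof -
      have x2: "fun_of_poly [:0, 0, 1:] = ?x * ?x" and x3: "fun_of_poly [:0, - 2:] = - 2 * ?x"
        using fun_of_poly_add[of "[:0, 1 :: rat:]" "[:0, 1:]"] fun_of_poly_minus[of "[:0, 2 :: rat:]"]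
        by (simp_all flip: fun_of_poly_mult)
      have "pu (A * A - B * B * f) + pu (B * B * f) = pu (A * A)"
        by (simp flip: pu_add)
      then have "pu (A * A - B * B * f) = pu (A * A) - pu (B * B * f)" by (simp only: eq_diff_eq)
      then have d: "pu (A * A - B * B * f) = pu A * pu A - pu B * pu B * W\<^sup>2"
        by (simp only: pu_mult W2)
      have "ev U G = (?x * pu C)\<^sup>2 - 2 * (?x * pu C) * pu A + pu A * pu A - pu B * pu B * W\<^sup>2"
        unfolding G_def by (simp only: ev_add ev_smult pu_ev x2 x3 d) (simp add: pu_mult power2_eq_square algebra_simps)
      also have "\<dots> = 0" unfolding x by (simp add: power2_eq_square algebra_simps)
      finally show ?thesis .
    qed
    ultimately show ?thesis using no_quadratic_relation[OF dh sf _ _ U] by blast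
  qed
  have pu_base: "pu p \<in> range to_ac" for p
    unfolding pu_ev[symmetric] using s by (simp add: U ev_base)
  \<comment> \<open>If \<open>W\<close> were a rational function of \<open>x\<close>, so would be
    the whole image of \<open>\<phi>\<close>, which contains \<open>y\<close>.\<close>
  have s': "s' \<noteq> 0"
  proof
    assume "s' = 0"
    then have W0: "W = to_ac r'" by (simp add: W)
    obtain A B C where C: "pu C \<noteq> 0" and y: "fun_y h * pu C = pu A + pu B * W"
      using img[of "fun_y h"] by auto
    obtain a b c where abc: "pu A = to_ac a" "pu B = to_ac b" "pu C = to_ac c" using pu_base by (metis rangeE)
    have "to_ac (- (a + b * r')) + to_ac c * fun_y h = 0"
      using y by (simp add: abc W0 algebra_simps)
    then have "c = 0" by (rule h.independent_fract(2))
    with C abc show False by simp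
  qed
  have y2: "fun_y h * fun_y h = to_ac (to_fract h)"
    using fun_y_square[of h] by (simp add: fun_of_poly_def Fract_1_eq_to_fract power2_eq_square)
  obtain v where v: "pu f = to_ac v" using pu_base by blast
  \<comment> \<open>Since \<open>W\<^sup>2 = f(U)\<close> is a rational function of
    \<open>x\<close>, the coefficient \<open>2 r' s'\<close> of \<open>y\<close> vanishes, and
    \<open>W\<close> is a multiple of \<open>y\<close>.\<close>
  have "to_ac (r' * r' + s' * s' * to_fract h - v) + to_ac (2 * r' * s') * fun_y h = 0"
    using W2 y2 by (simp add: v W power2_eq_square algebra_simps)
  from h.independent_fract[OF this] have "2 * r' * s' = 0" "v = r' * r' + s' * s' * to_fract h" by simp_all
  moreover have "(2 :: rat poly fract) \<noteq> 0"
    using to_fract_add[of 1 "1 :: rat poly"] by (metis one_add_one to_fract_1 to_fract_eq_0_iff zero_neq_numeral)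
  ultimately have r': "r' = 0" and v': "v = s'\<^sup>2 * to_fract h" using s' by (auto simp: power2_eq_square)

  obtain n d where d: "d \<noteq> 0" "coprime n d" and r: "r = to_fract n / to_fract d" by (rule fract_coprimeE)
  have U': "U = to_ac (to_fract n / to_fract d)" using U s r by simp
  have deg: "degree n \<le> 1" "degree d \<le> 1"
  proof -
    obtain a b c where abc: "pu A = to_ac a" "pu B = to_ac b" "pu C = to_ac c" using pu_base by (metis rangeE)
    have xr: "?x = to_ac (to_fract [:0, 1:])" by (simp add: fun_of_poly_def Fract_1_eq_to_fract)
    \<comment> \<open>As \<open>W\<close> is a multiple of \<open>y\<close>, the part of the
      relation for \<open>x\<close> that is free of \<open>y\<close> reads
      \<open>x C(U) = A(U)\<close>, of degree 1 in \<open>x\<close>.\<close>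
    have "to_ac (to_fract [:0, 1:] * c - a) + to_ac (- (b * s')) * fun_y h = 0"
      using x unfolding xr abc W r' by (simp add: algebra_simps)
    from h.independent_fract(1)[OF this] have "?x * pu C = pu A" unfolding xr abc by (simp flip: to_ac_mult)
    define G where "G = smult [:0, 1:] (lift_const C) - lift_const A"
    have cG: "coeff G j = [:- coeff A j, coeff C j:]" for j
      by (simp add: G_def lift_const_def coeff_map_poly)
    have "coeff G (degree C) \<noteq> 0" unfolding cG using pu_nz[OF C] by simp
    then have "G \<noteq> 0" by auto
    have "ev U (G + lift_const A) = ?x * pu C" by (simp add: G_def ev_smult pu_ev)
    then have "ev U G = 0" using \<open>?x * pu C = pu A\<close> by (simp add: ev_add pu_ev)
    then have "[:- n, d:] dvd G" unfolding U' using d by (intro ev_linear_dvd)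
    then obtain H where H: "G = [:- n, d:] * H" by (elim dvdE)
    have "degree (coeff [:- n, d:] j) \<le> 1" for j
    proof (rule factor_coeff_degree_le)
      show "[:- n, d:] * H \<noteq> 0" using H \<open>G \<noteq> 0\<close> by simp
      show "degree (coeff ([:- n, d:] * H) j) \<le> 1" for j
        unfolding H[symmetric] cG by (intro degree_le) (auto simp: coeff_pCons split: nat.split)
    qed
    from this[of 0] this[of 1] show "degree n \<le> 1" "degree d \<le> 1" by simp_all
  qed
  obtain b a where n: "n = [:b, a:]" using poly_degree_le_1[OF deg(1)] by blast
  obtain d0 c0 where dd: "d = [:d0, c0:]" using poly_degree_le_1[OF deg(2)] by blast
  have "pu f = to_ac (poly (map_poly (\<lambda>c. to_fract [:c:]) f) (to_fract n / to_fract d))"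
    unfolding pu_ev[symmetric] U' ev_base lift_const_def by (subst map_poly_map_poly) (auto simp: o_def)
  then have "v = poly (map_poly (\<lambda>c. to_fract [:c:]) f) (to_fract n / to_fract d)"
    unfolding v by simp
  \<comment> \<open>The denominator of \<open>f(n / d)\<close> is cleared by \<open>d^8\<close>
    although \<open>f\<close> has degree 7: the even exponent keeps the right side a square times
    \<open>h\<close>.\<close>
  then have "to_fract (homog8 f n d) = (to_fract d ^ 4 * s')\<^sup>2 * to_fract h"
    using ev_homog8[of f d n] d df v' by (simp add: power_mult_distrib)
  then obtain q where q: "homog8 f n d = q\<^sup>2 * h" using square_times_squarefree[OF sf] by blast
  have "q \<noteq> 0"
  proof
    assume "q = 0"
    then have "(to_fract d ^ 4 * s')\<^sup>2 * to_fract h = 0"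
      using q \<open>to_fract (homog8 f n d) = _\<close> by simp
    then show False using d s' h.f_nonzero by simp
  qed
  have "degree (homog8 f n d) \<le> 8"
    unfolding homog8_def
  proof (intro degree_sum_le)
    fix i :: nat assume i: "i \<in> {..8}"
    have "degree (n ^ i * d ^ (8 - i)) \<le> degree n * i + degree d * (8 - i)"
      by (intro order_trans[OF degree_mult_le] add_mono degree_power_le)
    also have "\<dots> \<le> 1 * i + 1 * (8 - i)" using deg by (intro add_mono mult_le_mono) auto
    finally show "degree (smult (coeff f i) (n ^ i * d ^ (8 - i))) \<le> 8"
      using i degree_smult_le order_trans by fastforce
  qed simp
  \<comment> \<open>Comparing degrees, \<open>2 * degree q + 7\<close> is at most 8.\<close>
  then have "degree q = 0"
    using \<open>q \<noteq> 0\<close> h.f_nonzero dh by (simp add: q degree_mult_eq power2_eq_square)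
  then obtain l where l: "q = [:l:]" by (rule degree_eq_zeroE)
  have "l \<noteq> 0" using l \<open>q \<noteq> 0\<close> by simp
  have "homog8 f [:b, a:] [:d0, c0:] = smult (l\<^sup>2) h"
    using q by (simp add: l n dd power2_eq_square)
  then have "(l\<^sup>2)\<^sup>2 * octic_invariant h = (a * d0 - b * c0) ^ 8 * octic_invariant f"
    using octic_invariant_homog8[of f d0 c0 b a] df d dd by (simp add: octic_invariant_smult)
  \<comment> \<open>The factor \<open>l\<^sup>2\<close> enters the quadratic invariant squared and
    the determinant enters as an eighth power, so their quotient is a fourth power.\<close>
  then have "octic_invariant h = ((a * d0 - b * c0)\<^sup>2 / l) ^ 4 * octic_invariant f"
    using \<open>l \<noteq> 0\<close> by (simp add: power_divide field_simps flip: power_mult)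
  then show ?thesis by blast
qed

section \<open>A family of curves of genus 3\<close>

definition family_numerator :: "'k::field_char_0 \<Rightarrow> 'k poly" where
  "family_numerator c = [:1, - 26, 286, - 1716, 6006, - 12012, c:]"

text \<open>This is the quotient of \<open>A\<^sup>2 - (1 - 4t)^13\<close> by \<open>t^6\<close>,
  with leading coefficient \<open>4^13\<close>. The constant term vanishes at
  \<open>c = 12012\<close>, the next Taylor coefficient of \<open>(1 - 4t)^(13/2)\<close>.\<close>

definition torsion_family :: "'k::field_char_0 \<Rightarrow> 'k poly" where
  "torsion_family c = [:2 * c - 24024, 631488 - 52 * c, 572 * c - 7047612, 43144816 - 3432 * c,
     12012 * c - 155604592, 327155712 - 24024 * c, c\<^sup>2 - 218103808, 67108864:]"

lemma torsion_family_identity: "(family_numerator c)\<^sup>2 - torsion_family c * ([:0, 0, 0, 1:])\<^sup>2 = [:1, - 4:] ^ 13"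
  by (simp add: family_numerator_def torsion_family_def power2_eq_square power_numeral_reduce algebra_simps)

lemma degree_torsion_family: "degree (torsion_family c) = 7"
  by (simp add: torsion_family_def)

text \<open>The power series \<open>(1 - 4t)\<^sup>1\<^sup>3\<^sup>/\<^sup>2\<close> is annihilated by \<open>(1 - 4t) d/dt + 26\<close>. At a double root of the
  curve polynomial this operator must annihilate the numerator too, which leaves a single
  candidate for the double root, and a rational one.\<close>

lemma family_numerator_ode:
  "[:1, - 4:] * pderiv (family_numerator c) + smult 26 (family_numerator c) = [:0, 0, 0, 0, 0, 6 * c - 72072, 2 * c:]"
  by (simp add: family_numerator_def pderiv_pCons algebra_simps)

lemma torsion_family_double_root:
  fixes c :: "'k::field_char_0"
  assumes root: "poly (torsion_family c) \<alpha> = 0" "poly (pderiv (torsion_family c)) \<alpha> = 0"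
    and c: "c \<noteq> 11088" "c \<noteq> 12012"
  shows "c * \<alpha> = 36036 - 3 * c" "(poly (family_numerator c) \<alpha>)\<^sup>2 = (1 - 4 * \<alpha>) ^ 13"
proof -
  let ?A = "poly (family_numerator c) \<alpha>" and ?A' = "poly (pderiv (family_numerator c)) \<alpha>" and ?u = "1 - 4 * \<alpha>"
  have "poly ((family_numerator c)\<^sup>2 - torsion_family c * ([:0, 0, 0, 1:])\<^sup>2) \<alpha> = poly ([:1, - 4:] ^ 13) \<alpha>"
    unfolding torsion_family_identity ..
  then show sq: "?A\<^sup>2 = ?u ^ 13" using root(1) by (simp add: mult.commute)
  have "poly (pderiv ((family_numerator c)\<^sup>2 - torsion_family c * ([:0, 0, 0, 1:])\<^sup>2)) \<alpha> = poly (pderiv ([:1, - 4:] ^ 13)) \<alpha>"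
    unfolding torsion_family_identity ..
  moreover have "poly (pderiv ([:1, - 4:] ^ 13)) \<alpha> = - 52 * ?u ^ 12"
    by (simp only: pderiv_power poly_mult poly_power poly_smult pderiv_pCons) (simp add: mult.commute)
  ultimately have d: "2 * ?A * ?A' = - 52 * ?u ^ 12"
    using root by (simp only: pderiv_diff pderiv_mult poly_diff poly_add poly_mult power2_eq_square)
      (simp add: algebra_simps)
  \<comment> \<open>The exclusion of 11088 keeps \<open>A\<close> from vanishing together with
    \<open>1 - 4t\<close> at \<open>t = 1/4\<close>, so that \<open>2 A\<close> can be cancelled
    below.\<close>
  have "poly (family_numerator c) (1 / 4) = (c - 11088) / 4096"
    by (simp add: family_numerator_def field_simps)
  then have "?A \<noteq> 0" if "?u = 0"
  proof -
    from that have "\<alpha> = 1 / 4" by (simp add: field_simps)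
    moreover have "poly (family_numerator c) (1 / 4) \<noteq> 0"
      unfolding \<open>poly (family_numerator c) (1 / 4) = _\<close> using c(1) by simp
    ultimately show ?thesis unfolding \<open>\<alpha> = 1 / 4\<close> by (simp only: simp_thms not_False_eq_True)
  qed
  then have A0: "?A \<noteq> 0" using sq by (metis power_eq_0_iff zero_power2)
  \<comment> \<open>Multiplying the differentiated identity by \<open>u\<close> and inserting
    \<open>u^13 = A\<^sup>2\<close> produces the common factor \<open>2 A\<close>.\<close>
  have "2 * ?A * (?u * ?A') = ?u * (2 * ?A * ?A')" by (simp only: mult_ac)
  also have "\<dots> = - 52 * ?u ^ 13" unfolding d by (simp add: power_numeral_reduce)
  also have "\<dots> = 2 * ?A * (- 26 * ?A)" unfolding sq[symmetric] by (simp add: power2_eq_square)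
  finally have "2 * ?A * (?u * ?A') = 2 * ?A * (- 26 * ?A)" .
  moreover have "2 * ?A \<noteq> 0" using A0 by simp
  ultimately have "?u * ?A' = - 26 * ?A" using mult_left_cancel by blast
  moreover have "poly ([:1, - 4:] * pderiv (family_numerator c) + smult 26 (family_numerator c)) \<alpha>
      = poly [:0, 0, 0, 0, 0, 6 * c - 72072, 2 * c:] \<alpha>" unfolding family_numerator_ode ..
  ultimately have "\<alpha> ^ 5 * (6 * c - 72072 + 2 * (c * \<alpha>)) = 0"
    by (simp add: algebra_simps power_numeral_reduce)
  \<comment> \<open>The curve polynomial has the value \<open>2 (c - 12012)\<close> at 0, kept
    nonzero by the second exclusion; the remaining linear factor determines
    \<open>\<alpha>\<close>.\<close>
  moreover have "\<alpha> \<noteq> 0"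
  proof
    assume "\<alpha> = 0"
    then have "2 * c - 24024 = 0" using root(1) by (simp add: torsion_family_def)
    then have "2 * c = 2 * 12012" by simp
    then show False using c(2) by (simp only: mult_left_cancel zero_neq_numeral[symmetric] not_False_eq_True)
  qed
  ultimately have "6 * c - 72072 + 2 * (c * \<alpha>) = 0" by simp
  then have "2 * (c * \<alpha>) = 2 * (36036 - 3 * c)" by (simp add: algebra_simps eq_diff_eq add_eq_0_iff)
  then show "c * \<alpha> = 36036 - 3 * c" by (simp only: mult_left_cancel zero_neq_numeral[symmetric] not_False_eq_True)
qed

lemma base_change_torsion_family: "base_change (torsion_family c) = torsion_family (to_ac c)"
  by (simp add: base_change_def torsion_family_def map_poly_pCons power2_eq_square)

lemma poly_family_numerator_to_ac: "poly (family_numerator (to_ac c)) (to_ac q) = to_ac (poly (family_numerator c) q)"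
  by (simp add: family_numerator_def)

text \<open>The only candidate is \<open>q = 36036 p - 3\<close>. It makes \<open>1 - 4 q\<close>
  negative, and the odd power 13 of a negative rational is not a rational square.\<close>

lemma torsion_family_no_double_root:
  fixes p :: nat
  assumes p: "p > 0" and c: "c = 1 / of_nat p" and root: "poly (base_change (torsion_family c)) \<alpha> = 0"
  shows "poly (pderiv (base_change (torsion_family c))) \<alpha> \<noteq> 0"
proof
  assume "poly (pderiv (base_change (torsion_family c))) \<alpha> = 0"
  then have root': "poly (pderiv (torsion_family (to_ac c))) \<alpha> = 0" and root: "poly (torsion_family (to_ac c)) \<alpha> = 0"
    using root by (simp_all add: base_change_torsion_family)
  have le: "c \<le> 1" "c \<noteq> 0" using p by (simp_all add: c)
  have "to_ac c \<noteq> 11088" "to_ac c \<noteq> 12012"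
    using le to_ac_eq_iff[of c 11088] to_ac_eq_iff[of c 12012] by auto
  note dr = torsion_family_double_root[OF root root' this]
  define q where "q = (36036 - 3 * c) / c"
  have "\<alpha> = to_ac q" using dr(1) le(2) by (simp add: q_def field_simps)
  then have "to_ac ((poly (family_numerator c) q)\<^sup>2) = to_ac ((1 - 4 * q) ^ 13)"
    using dr(2) by (simp add: poly_family_numerator_to_ac)
  then have "(poly (family_numerator c) q)\<^sup>2 = (1 - 4 * q) ^ 13" by (simp only: to_ac_eq_iff)
  moreover have "1 - 4 * q < 0"
  proof -
    have "q = 36036 * of_nat p - 3" using p by (simp add: q_def c field_simps)
    moreover have "(1 :: rat) \<le> of_nat p" using p by simp
    ultimately show ?thesis by linarith
  qed
  then have "(1 - 4 * q) ^ 13 < 0" by (simp add: power_less_zero_eq)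
  ultimately show False by (metis not_less zero_le_power2)
qed

text \<open>A nonconstant \<open>g\<close> with \<open>g\<^sup>2\<close> dividing \<open>f\<close>
  has a root in the algebraic closure, which is a double root of \<open>f\<close>.\<close>

lemma squarefree_base_change:
  assumes "f \<noteq> 0" and simple: "\<And>\<alpha>. poly (base_change f) \<alpha> = 0 \<Longrightarrow> poly (pderiv (base_change f)) \<alpha> \<noteq> 0"
  shows "squarefree f"
  unfolding squarefree_def
proof (intro allI impI)
  fix g assume "g\<^sup>2 dvd f"
  then obtain k where "f = g\<^sup>2 * k" by (elim dvdE)
  then have k: "f = g * (g * k)" by (simp add: power2_eq_square mult.assoc)
  have "degree g = 0"
  proof (rule ccontr)
    assume "degree g \<noteq> 0"
    then have "degree (base_change g) > 0" by (simp add: degree_base_change)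
    then obtain \<alpha> where \<alpha>: "poly (base_change g) \<alpha> = 0" using alg_closed_imp_poly_has_root by blast
    have "base_change f = base_change g * (base_change g * base_change k)"
      unfolding k base_change_def by (simp only: map_poly_hom_mult[OF to_ac_0 to_ac_add to_ac_mult])
    then show False using simple[of \<alpha>] \<alpha> by (simp add: pderiv_mult)
  qed
  moreover have "g \<noteq> 0" using k assms(1) by auto
  ultimately show "g dvd 1" by (auto simp: is_unit_iff_degree)
qed

section \<open>Functions regular away from infinity\<close>

lemma add_diff_eq_0_imp:
  fixes x y :: "'a::field_char_0"
  assumes "x + y = 0" "x - y = 0"
  shows "x = 0" "y = 0"
proof -
  have "2 * x = (x + y) + (x - y)" by simp
  then show "x = 0" unfolding assms by simp
  then show "y = 0" using assms(1) by simp
qed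

text \<open>For simple roots of \<open>f\<close> the ring of polynomials in \<open>x\<close> and
  \<open>y\<close> is integrally closed. Elementwise: in a representation whose denominator
  \<open>c\<close> has least degree, a root of \<open>c\<close> would be a common root of
  \<open>a\<close> and \<open>b\<close> and could be cancelled.\<close>

lemma regular_function_polynomial:
  fixes f :: "'k::{field_char_0, alg_closed_field} poly"
  assumes odd: "odd (degree f)"
    and simple: "\<And>\<alpha>. poly f \<alpha> = 0 \<Longrightarrow> poly (pderiv f) \<alpha> \<noteq> 0"
    and z: "z \<in> function_field f" "z \<noteq> 0"
    and reg: "\<And>v. v \<in> curve_points f \<Longrightarrow> 0 \<le> v (fun_of_poly [:0, 1:]) \<Longrightarrow> 0 \<le> v z"
  obtains a b where "z = fun_of_poly a + fun_of_poly b * fun_y f"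
proof -
  interpret odd_hyperelliptic f by unfold_locales fact
  define rep where "rep = (\<lambda>(a, b, c). c \<noteq> 0 \<and> z = (fun_of_poly a + fun_of_poly b * fun_y f) / fun_of_poly c)"
  obtain a\<^sub>0 b\<^sub>0 c\<^sub>0 where "c\<^sub>0 \<noteq> 0" "z = (fun_of_poly a\<^sub>0 + fun_of_poly b\<^sub>0 * fun_y f) / fun_of_poly c\<^sub>0"
    using z(1) by (rule function_fieldE)
  then have "rep (a\<^sub>0, b\<^sub>0, c\<^sub>0)" by (simp add: rep_def)
  then obtain T where T: "rep T" and least: "\<And>T'. rep T' \<Longrightarrow> degree (snd (snd T)) \<le> degree (snd (snd T'))"
    using ex_has_least_nat[of rep _ "\<lambda>t. degree (snd (snd t))"] by blast
  obtain a b c where abc: "T = (a, b, c)" by (cases T)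
  have c: "c \<noteq> 0" and zz: "z = (fun_of_poly a + fun_of_poly b * fun_y f) / fun_of_poly c"
    using T by (simp_all add: abc rep_def)
  have ab: "fun_of_poly a + fun_of_poly b * fun_y f \<noteq> 0" using z(2) zz by auto
  have "degree c = 0"
  proof (rule ccontr)
    assume "degree c \<noteq> 0"
    then obtain \<alpha> where \<alpha>: "poly c \<alpha> = 0" using alg_closed_imp_poly_has_root by blast
    have pos: "v (fun_of_poly [:- \<alpha>, 1:]) \<le> v (fun_of_poly a + fun_of_poly b * fun_y f)"
      if "finite_place f v \<alpha>" for v
    proof -
      interpret finite_place f v \<alpha> by fact
      have "at_least 0 (fun_of_poly [:0, 1:])" by (rule poly_integral)
      then have "0 \<le> v (fun_of_poly [:0, 1:])" by (simp add: at_least_def)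
      then have "0 \<le> v z" by (rule reg[OF place])
      moreover have "v z = v (fun_of_poly a + fun_of_poly b * fun_y f) - v (fun_of_poly c)"
        unfolding zz using c ab by (intro v_divide) auto
      ultimately have 1: "v (fun_of_poly c) \<le> v (fun_of_poly a + fun_of_poly b * fun_y f)" by linarith
      have "1 \<le> order \<alpha> c" using \<alpha> c by (simp add: order_root Suc_le_eq)
      then have "v t * 1 \<le> v t * int (order \<alpha> c)" using above by (intro mult_left_mono) auto
      then have "v t \<le> v (fun_of_poly c)" using v_order[OF c] by (simp add: mult.commute)
      with 1 show ?thesis by linarith
    qed
    have "poly a \<alpha> = 0 \<and> poly b \<alpha> = 0"
    proof (cases "poly f \<alpha> = 0")
      case False
      obtain \<eta> where \<eta>: "\<eta>\<^sup>2 = poly f \<alpha>" using nth_root_exists[of 2 "poly f \<alpha>"] by auto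
      \<comment> \<open>The two places over \<open>\<alpha>\<close>, with \<open>y\<close> equal to
        \<open>\<eta>\<close> and \<open>- \<eta>\<close>, give two linear equations for the values
        of \<open>a\<close> and \<open>b\<close>.\<close>
      have lin: "poly a \<alpha> + poly b \<alpha> * \<eta>' = 0" if eta: "poly f \<alpha> = \<eta>'\<^sup>2" "\<eta>' \<noteq> 0" for \<eta>'
      proof (rule ccontr)
        assume nz: "poly a \<alpha> + poly b \<alpha> * \<eta>' \<noteq> 0"
        obtain v where v: "unram_at f \<alpha> \<eta>' v" using unram_at_exists[OF odd eta] .
        interpret unramified_place f v \<alpha> \<eta>' using v eta by (intro unram_at_locale) auto
        show False using pos[OF finite_place_axioms] v_lin_unit[OF nz] above by simp
      qed
      have "\<eta> \<noteq> 0" using \<eta> False by auto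
      have "poly f \<alpha> = (- \<eta>)\<^sup>2" "- \<eta> \<noteq> 0" using \<eta> \<open>\<eta> \<noteq> 0\<close> by simp_all
      from lin[OF this] lin[OF \<eta>[symmetric] \<open>\<eta> \<noteq> 0\<close>]
      have "poly a \<alpha> + poly b \<alpha> * \<eta> = 0" "poly a \<alpha> - poly b \<alpha> * \<eta> = 0"
        by simp_all
      then have "poly a \<alpha> = 0" "poly b \<alpha> * \<eta> = 0"
        using add_diff_eq_0_imp by blast+
      then show ?thesis using \<open>\<eta> \<noteq> 0\<close> by simp
    next
      case True
      obtain v where v: "v \<in> curve_points f" "v (fun_of_poly [:- \<alpha>, 1:]) = 2"
        using ramified_place_exists[OF odd True simple[OF True]] .
      interpret finite_place f v \<alpha> using v by unfold_locales auto
      obtain g where f: "f = [:- \<alpha>, 1:] * g" using True by (auto simp: poly_eq_0_iff_dvd elim: dvdE)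
      have "poly (pderiv f) \<alpha> = poly g \<alpha>"
        by (simp only: f pderiv_mult poly_add poly_mult) (simp add: pderiv_pCons)
      then have g: "poly g \<alpha> \<noteq> 0" using simple[OF True] by simp
      then have "g \<noteq> 0" by auto
      have y0: "fun_y f \<noteq> 0" using fun_y_square[of f] f_nonzero by auto
      have "v (fun_of_poly f) = v t + v (fun_of_poly g)"
        unfolding f fun_of_poly_mult using \<open>g \<noteq> 0\<close> by (intro v_mult) auto
      then have "v (fun_of_poly f) = 2" using v v_unit[OF g] by simp
      \<comment> \<open>Here \<open>y\<close> has value 1 and \<open>x - \<alpha>\<close> has value
        2. A nonzero \<open>a(\<alpha>)\<close> would give the numerator value 0, and after that a
        nonzero \<open>b(\<alpha>)\<close> would give it value 1, both below 2.\<close>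
      then have vy: "v (fun_y f) = 1" using v_power[of "fun_y f" 2] y0 by (simp add: fun_y_square)
      let ?A = "fun_of_poly a" and ?B = "fun_of_poly b * fun_y f"
      have ge: "2 \<le> v (?A + ?B)" using pos[OF finite_place_axioms] v by simp
      have "at_least (0 + 1) ?B"
        by (intro at_least_mult poly_integral) (simp add: at_least_def vy)
      then have B: "at_least 1 ?B" by simp
      have a: "poly a \<alpha> = 0"
      proof (rule ccontr)
        assume nz: "poly a \<alpha> \<noteq> 0"
        then have "?A \<noteq> 0" by auto
        then have "v (?A + ?B) = v ?A" using B v_unit[OF nz] by (intro v_add_eq(2)) auto
        then show False using ge v_unit[OF nz] by simp
      qed
      have "poly b \<alpha> = 0"
      proof (rule ccontr)
        assume nz: "poly b \<alpha> \<noteq> 0"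
        then have "b \<noteq> 0" by auto
        then have vB: "v ?B = 1" using y0 v_unit[OF nz] vy by (simp add: v_mult)
        have "at_least 2 ?A" using minus_value[of a] a v by simp
        then have "v (?B + ?A) = v ?B" using vB \<open>b \<noteq> 0\<close> y0 by (intro v_add_eq(2)) auto
        then show False using ge vB by (simp add: add.commute)
      qed
      with a show ?thesis by simp
    qed
    then obtain a' b' c' where *: "a = [:- \<alpha>, 1:] * a'" "b = [:- \<alpha>, 1:] * b'" "c = [:- \<alpha>, 1:] * c'"
      using \<alpha> unfolding poly_eq_0_iff_dvd by (metis dvdE)
    have "c' \<noteq> 0" using * c by auto
    have "z = (fun_of_poly [:- \<alpha>, 1:] * (fun_of_poly a' + fun_of_poly b' * fun_y f)) / (fun_of_poly [:- \<alpha>, 1:] * fun_of_poly c')"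
      unfolding zz * fun_of_poly_mult by (simp only: distrib_left mult.assoc)
    also have "\<dots> = (fun_of_poly a' + fun_of_poly b' * fun_y f) / fun_of_poly c'"
      by (rule mult_divide_mult_cancel_left) simp
    finally have "rep (a', b', c')" using \<open>c' \<noteq> 0\<close> unfolding rep_def by simp
    from least[OF this] have "degree c \<le> degree c'" by (simp add: abc)
    moreover have "degree c = Suc (degree c')" using \<open>c' \<noteq> 0\<close> unfolding *(3) by (subst degree_mult_eq) auto
    ultimately show False by simp
  qed
  then obtain l where l: "c = [:l:]" by (rule degree_eq_zeroE)
  have "l \<noteq> 0" using c l by auto
  have 1: "fun_of_poly [:1 / l:] * fun_of_poly c = 1"
    using \<open>l \<noteq> 0\<close> by (simp add: l one_pCons[symmetric] flip: fun_of_poly_mult)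
  have "z = z * (fun_of_poly [:1 / l:] * fun_of_poly c)" unfolding 1 by simp
  also have "\<dots> = fun_of_poly [:1 / l:] * (fun_of_poly a + fun_of_poly b * fun_y f)"
    using c by (simp add: zz)
  also have "\<dots> = fun_of_poly ([:1 / l:] * a) + fun_of_poly ([:1 / l:] * b) * fun_y f"
    by (simp only: fun_of_poly_mult distrib_left mult.assoc)
  finally show ?thesis using that by blast
qed

text \<open>The degree is even if \<open>a\<^sup>2\<close> dominates and at least
  \<open>deg f\<close> if \<open>f * b\<^sup>2\<close> does. This gap keeps \<open>a + b y\<close>
  from having a simple pole at infinity.\<close>

lemma (in odd_hyperelliptic) degree_norm_neq_1:
  assumes "degree f \<noteq> 1" shows "degree (a\<^sup>2 - f * b\<^sup>2) \<noteq> 1"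
proof (cases "b = 0")
  case True
  then show ?thesis by (cases "a = 0") (simp_all add: power2_eq_square degree_mult_eq, presburger)
next
  case False
  have q: "degree (f * b\<^sup>2) = degree f + 2 * degree b"
    using False f_nonzero by (simp add: power2_eq_square degree_mult_eq)
  have p: "degree (a\<^sup>2) = 2 * degree a"
    by (cases "a = 0") (simp_all add: power2_eq_square degree_mult_eq)
  have "degree f > 1" using assms odd_degree by (metis even_zero less_one linorder_neqE_nat)
  have "degree (a\<^sup>2) \<noteq> degree (f * b\<^sup>2)" unfolding p q using odd_degree by presburger
  then consider "degree (a\<^sup>2) < degree (f * b\<^sup>2)" | "degree (f * b\<^sup>2) < degree (a\<^sup>2)" by linarith
  then show ?thesis
  proof cases
    case 1
    then have "degree (a\<^sup>2 - f * b\<^sup>2) = degree (f * b\<^sup>2)"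
      using degree_add_eq_right[of "a\<^sup>2" "- (f * b\<^sup>2)"] by simp
    then show ?thesis using q \<open>degree f > 1\<close> by simp
  next
    case 2
    then have "degree (a\<^sup>2 - f * b\<^sup>2) = degree (a\<^sup>2)"
      using degree_add_eq_left[of "- (f * b\<^sup>2)" "a\<^sup>2"] by simp
    then show ?thesis using 2 q \<open>degree f > 1\<close> by simp
  qed
qed

section \<open>Galois-fixed places\<close>

lemma galois_point_unram:
  fixes f :: "rat poly"
  assumes odd: "odd (degree f)" and \<sigma>: "\<sigma> \<in> abs_galois"
    and on: "poly (base_change f) (to_ac q) = (to_ac e)\<^sup>2" "e \<noteq> 0"
    and P: "unram_at (base_change f) (to_ac q) (to_ac e) P"
  shows "galois_point f \<sigma> P = P"
proof -
  interpret galois_action f \<sigma> using odd \<sigma> by unfold_locales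
  interpret I: galois_action f \<sigma>' by (rule galois_action_inv)
  have [simp]: "map_poly \<sigma>' [:- to_ac q, 1:] = [:- to_ac q, 1:]" "map_poly \<sigma>' [:to_ac e:] = [:to_ac e:]"
    using abs_galoisD(4)[OF I.galois, of "- q"] abs_galoisD(4)[OF I.galois, of 1] abs_galoisD(4)[OF I.galois, of e]
      abs_galoisD(5)[OF I.galois]
    by (simp_all add: map_poly_pCons)
  \<comment> \<open>The coordinates are rational, so the image place lies over the same point, and
    only one place does.\<close>
  have "unram_at (base_change f) (to_ac q) (to_ac e) (galois_point f \<sigma> P)"
    using P galois_point_closed[of P]
    by (auto simp: unram_at_def galois_point_def I.galois_fun_fun_of_poly I.galois_fun_diff I.galois_fun_fun_y)
  then show ?thesis using P on by (intro H.unram_at_unique[of "to_ac q" "to_ac e"]) auto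
qed

lemma galois_point_infinite:
  fixes f :: "rat poly"
  assumes odd: "odd (degree f)" and \<sigma>: "\<sigma> \<in> abs_galois" and P: "infinite_place (base_change f) P"
  shows "galois_point f \<sigma> P = P"
proof -
  interpret galois_action f \<sigma> using odd \<sigma> by unfold_locales
  interpret I: galois_action f \<sigma>' by (rule galois_action_inv)
  interpret P: infinite_place "base_change f" P by fact
  have [simp]: "map_poly \<sigma>' [:0, 1:] = [:0, 1:]"
    using abs_galoisD(4)[OF I.galois, of 1] abs_galoisD(5)[OF I.galois] by (simp add: map_poly_pCons)
  have "infinite_place (base_change f) (galois_point f \<sigma> P)"
    using P.pole galois_point_closed[OF P.place]
    by unfold_locales (auto simp: galois_point_def I.galois_fun_fun_of_poly)
  then show ?thesis using P by (rule H.infinite_place_unique)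
qed

section \<open>The torsion point and the theorem\<close>

lemma torsion_family_torsion_point:
  fixes p :: nat
  assumes p: "p > 0" and c: "c = 1 / of_nat p"
  shows "\<exists>A\<in>carrier (jacobian_rational_points (torsion_family c)).
           group.ord (jacobian_rational_points (torsion_family c)) A = 13"
proof -
  let ?F = "base_change (torsion_family c)"
  have odd: "odd (degree (torsion_family c))" by (simp add: degree_torsion_family)
  have oddF: "odd (degree ?F)" by (simp add: degree_base_change degree_torsion_family)
  interpret odd_hyperelliptic ?F by unfold_locales (fact oddF)
  define a where "a = (family_numerator (to_ac c) :: rat alg_closure poly)"
  define b where "b = ([:0, 0, 0, 1:] :: rat alg_closure poly)"
  define w where "w = fun_of_poly a + fun_of_poly b * fun_y ?F"
  \<comment> \<open>The \<open>y\<close>-coordinate at which \<open>A + t^3 y\<close> vanishes for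
    \<open>t = 1/4\<close>, where \<open>t^3 = 1/64\<close>.\<close>
  define e where "e = - 64 * poly (family_numerator c) (1 / 4)"
  define \<alpha> where "\<alpha> = (to_ac (1 / 4) :: rat alg_closure)"
  define \<eta> where "\<eta> = (to_ac e :: rat alg_closure)"
  have norm: "a\<^sup>2 - ?F * b\<^sup>2 = [:1, - 4:] ^ 13"
    unfolding a_def b_def base_change_torsion_family by (rule torsion_family_identity)
  \<comment> \<open>This makes the \<open>y\<close>-coordinate nonzero, so the point is unramified
    and \<open>x - 1/4\<close> is a uniformiser there.\<close>
  have "c \<noteq> 11088" using p by (auto simp: c field_simps)
  moreover have "4096 * poly (family_numerator c) (1 / 4) = c - 11088"
    by (simp add: family_numerator_def field_simps)
  ultimately have "poly (family_numerator c) (1 / 4) \<noteq> 0" by auto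
  then have e: "e \<noteq> 0" by (simp add: e_def)
  then have eta0: "\<eta> \<noteq> 0" by (simp add: \<eta>_def)
  have a\<alpha>: "poly a \<alpha> = - \<eta> / 64" unfolding a_def \<alpha>_def poly_family_numerator_to_ac by (simp add: \<eta>_def e_def)
  have b\<alpha>: "poly b \<alpha> = 1 / 64" by (simp add: b_def \<alpha>_def)
  have "poly (a\<^sup>2 - ?F * b\<^sup>2) \<alpha> = 0" unfolding norm by (simp add: \<alpha>_def)
  then have on: "poly ?F \<alpha> = \<eta>\<^sup>2" by (simp add: a\<alpha> b\<alpha> power2_eq_square field_simps)
  have on': "poly ?F \<alpha> = (- \<eta>)\<^sup>2" using on by simp
  have two: "(2 :: rat alg_closure) \<noteq> 0" by simp
  have aw: "a \<noteq> 0 \<or> b \<noteq> 0" by (simp add: b_def)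
  have w: "w \<in> function_field ?F" "w \<noteq> 0" using aw independent_iff[of a b] by (auto simp: w_def)
  obtain P where P: "unram_at ?F \<alpha> \<eta> P" using unram_at_exists[OF oddF on eta0] .
  obtain Q where Q: "infinite_place ?F Q" using infinite_place_exists[OF oddF] .
  have PC: "P \<in> curve_points ?F" using P by (simp add: unram_at_def)
  interpret Q: infinite_place ?F Q by fact
  have norm_factor: "fun_of_poly ([:1, - 4:] ^ 13) = (fun_of_poly [:- 4:] * fun_of_poly [:- \<alpha>, 1:]) ^ 13"
    by (simp add: \<alpha>_def flip: fun_of_poly_mult)
  have vP: "P w = 13"
  proof -
    interpret unramified_place ?F P \<alpha> \<eta> using P on eta0 two by (rule unram_at_locale)
    have "P w = P (fun_of_poly (a\<^sup>2 - ?F * b\<^sup>2))"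
      unfolding w_def using eta0 by (intro v_lin_zero) (simp_all add: a\<alpha> b\<alpha>)
    also have "\<dots> = 13 * (P (fun_of_poly [:- 4:]) + P t)"
      unfolding norm norm_factor by (subst v_power v_mult; simp)+
    also have "P t = 1" by (rule unram_at_uniformiser[OF on eta0 two P])
    finally show ?thesis using v_const[of "- 4"] by simp
  qed
  have vQ: "Q w = - 13"
    using Q.v_lin[OF aw] infinite_place_x[OF Q] unfolding norm w_def[symmetric]
    by (simp add: degree_power_eq)
  \<comment> \<open>Any further place over \<open>1/4\<close> has the opposite
    \<open>y\<close>-coordinate, where \<open>w\<close> does not vanish. At the remaining finite
    places \<open>w\<close> and its conjugate are integral and their product is a unit.\<close>
  have other: "R w = 0" if R: "R \<in> curve_points ?F" "R \<noteq> P" "R \<noteq> Q" for R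
  proof -
    interpret R: place ?F R by unfold_locales fact
    have "\<not> R (fun_of_poly [:0, 1:]) < 0"
    proof
      assume "R (fun_of_poly [:0, 1:]) < 0"
      then have "infinite_place ?F R" by unfold_locales
      then show False using infinite_place_unique[OF _ Q] R by blast
    qed
    then have x: "R.at_least 0 (fun_of_poly [:0, 1:])" by (simp add: R.at_least_def)
    note int = R.at_least_poly[OF x]
    have y0: "fun_y ?F \<noteq> 0" using fun_y_square[of ?F] f_nonzero by auto
    have "2 * R (fun_y ?F) = R (fun_of_poly ?F)" using R.v_power[of "fun_y ?F" 2] y0 by (simp add: fun_y_square)
    moreover have "0 \<le> R (fun_of_poly ?F)" using int[of ?F] f_nonzero by (simp add: R.at_least_def)
    ultimately have y: "R.at_least 0 (fun_y ?F)" by (simp add: R.at_least_def)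
    let ?t = "fun_of_poly [:- \<alpha>, 1:]"
    show ?thesis
    proof (cases "0 < R ?t")
      case True
      let ?z1 = "fun_y ?F - fun_of_poly [:\<eta>:]" and ?z2 = "fun_y ?F - fun_of_poly [:- \<eta>:]"
      have n1: "\<not> unram_at ?F \<alpha> \<eta> R" using unram_at_unique[OF on eta0 two _ P] R by blast
      interpret Rf: finite_place ?F R \<alpha> using True by unfold_locales
      have "unram_at ?F \<alpha> (- \<eta>) R"
      proof (rule ccontr)
        assume n2: "\<not> unram_at ?F \<alpha> (- \<eta>) R"
        have z: "?z1 \<noteq> 0" "?z2 \<noteq> 0" "\<not> 0 < R ?z1" "\<not> 0 < R ?z2"
          using n1 n2 R True by (auto simp: unram_at_def)
        \<comment> \<open>The product of \<open>y - \<eta>\<close> and \<open>y + \<eta>\<close> is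
          \<open>f - f(\<alpha>)\<close>, which vanishes at the place, so one factor must vanish
          there.\<close>
        have "?z1 * ?z2 = fun_of_poly ?F - fun_of_poly [:poly ?F \<alpha>:]"
        proof -
          have "fun_of_poly [:- \<eta>:] = - fun_of_poly [:\<eta>:]" "fun_of_poly [:poly ?F \<alpha>:] = fun_of_poly [:\<eta>:] * fun_of_poly [:\<eta>:]"
            by (simp_all add: on power2_eq_square flip: fun_of_poly_minus fun_of_poly_mult)
          then show ?thesis by (simp add: algebra_simps power2_eq_square flip: fun_y_square[of ?F])
        qed
        then have "R.at_least (R ?t) (?z1 * ?z2)" using Rf.minus_value[of ?F] by simp
        then have "R ?t \<le> R ?z1 + R ?z2" using z by (simp add: R.at_least_def R.v_mult)
        then show False using z True by linarith
      qed
      then interpret Ru: unramified_place ?F R \<alpha> "- \<eta>" using on' eta0 two by (intro unram_at_locale) auto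
      show ?thesis unfolding w_def using eta0 by (intro Ru.v_lin_unit) (simp add: a\<alpha> b\<alpha>)
    next
      case False
      have wi: "0 \<le> R w"
        using R.at_least_add[OF int[of a] R.at_least_mult[OF int[of b] y, simplified]] w
        by (simp add: R.at_least_def w_def)
      define w' where "w' = fun_of_poly a + fun_of_poly (- b) * fun_y ?F"
      have "w' \<noteq> 0" unfolding w'_def using aw independent_iff[of a "- b"] by simp
      moreover have "w' \<in> function_field ?F" unfolding w'_def by simp
      ultimately have wi': "0 \<le> R w'"
        using R.at_least_add[OF int[of a] R.at_least_mult[OF int[of "- b"] y, simplified]]
        by (simp add: R.at_least_def w'_def)
      have "w * w' = fun_of_poly (a\<^sup>2 - ?F * b\<^sup>2)"
        by (simp add: w_def w'_def algebra_simps power2_eq_square flip: fun_y_square[of ?F])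
      then have "R w + R w' = R (fun_of_poly (a\<^sup>2 - ?F * b\<^sup>2))"
        using R.v_mult[of w w'] w \<open>w' \<noteq> 0\<close> \<open>w' \<in> _\<close> by simp
      also have "\<dots> = 13 * (R (fun_of_poly [:- 4:]) + R ?t)"
        unfolding norm norm_factor by (subst R.v_power R.v_mult; simp)+
      finally show ?thesis using wi wi' False R.v_const[of "- 4"] by simp
    qed
  qed
  have PQ: "P \<noteq> Q" using vP vQ by auto
  define D where "D = frag_of P - frag_of Q"
  have keys: "Poly_Mapping.keys D \<subseteq> curve_points ?F"
    using keys_diff[of "frag_of P" "frag_of Q"] PC Q.place by (auto simp: D_def)
  then have D: "D \<in> carrier (div0_group ?F)" by (simp add: div0_group_simps D_def divisor_degree_diff)
  have "galois_divisor (torsion_family c) \<sigma> D = D" if "\<sigma> \<in> abs_galois" for \<sigma>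
    using galois_point_unram[OF odd that _ e, of "1 / 4" P] galois_point_infinite[OF odd that Q] P on
    by (simp add: D_def galois_divisor_simps \<alpha>_def \<eta>_def)
  moreover have "frag_cmul (int 13) D \<in> principal_divisors ?F"
  proof -
    have "frag_cmul 13 D \<in> carrier (div0_group ?F)"
    proof -
      interpret G: comm_group "div0_group ?F" by (rule div0_comm_group)
      have "D [^]\<^bsub>div0_group ?F\<^esub> n = frag_cmul (int n) D" for n :: nat
        by (induction n) (simp_all add: div0_group_simps frag_cmul_distrib add.commute)
      then show ?thesis using G.nat_pow_closed[OF D, of 13] by simp
    qed
    moreover have "Poly_Mapping.lookup (frag_cmul 13 D) R = R w" if "R \<in> curve_points ?F" for R
      using other[OF that] vP vQ PQ by (auto simp: D_def lookup_minus)
    ultimately show ?thesis using w unfolding principal_divisors_def by auto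
  qed
  moreover have "D \<notin> principal_divisors ?F"
  proof
    assume "D \<in> principal_divisors ?F"
    then obtain z where z: "z \<in> function_field ?F" "z \<noteq> 0"
      and div: "\<And>R. R \<in> curve_points ?F \<Longrightarrow> Poly_Mapping.lookup D R = R z"
      unfolding principal_divisors_def by blast
    have "0 \<le> R z" if "R \<in> curve_points ?F" "0 \<le> R (fun_of_poly [:0, 1:])" for R
    proof -
      have "R \<noteq> Q" using that(2) Q.pole by auto
      then show ?thesis unfolding div[OF that(1), symmetric] by (simp add: D_def lookup_minus)
    qed
    then obtain a' b' where ab: "z = fun_of_poly a' + fun_of_poly b' * fun_y ?F"
      using regular_function_polynomial[OF oddF torsion_family_no_double_root[OF p c] z] by metis
    then have "a' \<noteq> 0 \<or> b' \<noteq> 0" using z by auto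
    \<comment> \<open>At infinity the pole order of \<open>a' + b' y\<close> is the degree of its
      norm, and \<open>D\<close> asks for the excluded value 1.\<close>
    from Q.v_lin[OF this] have "Q z = - int (degree (a'\<^sup>2 - ?F * b'\<^sup>2))"
      unfolding ab[symmetric] infinite_place_x[OF Q] by simp
    moreover have "Q z = - 1" unfolding div[OF Q.place, symmetric] using PQ by (simp add: D_def lookup_minus)
    ultimately have "degree (a'\<^sup>2 - ?F * b'\<^sup>2) = 1" by simp
    moreover have "degree ?F \<noteq> 1" by (simp add: degree_base_change degree_torsion_family)
    ultimately show False using degree_norm_neq_1 by blast
  qed
  moreover have "Factorial_Ring.prime (13 :: nat)" by (simp add: prime_nat_numeral_eq)
  ultimately show ?thesis by (intro jacobian_point_of_prime_order[OF odd D])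
qed

section \<open>The invariant along the family and its p-adic valuation\<close>

definition family_invariant_numerator :: "int \<Rightarrow> int" where
  "family_invariant_numerator n = 5720 - 194151672 * n + 2194642230144 * n ^ 2 - 8261922220744192 * n ^ 3"

text \<open>Only the product of the coefficients of \<open>t^2\<close> and \<open>t^6\<close>
  contributes to \<open>c^3\<close>, with \<open>10 * 572 = 5720\<close>. After multiplication by
  \<open>n^3\<close> this is the constant term of the numerator.\<close>

lemma invariant_family:
  assumes "n > 0"
  shows "of_nat n ^ 3 * octic_invariant (torsion_family (1 / of_nat n)) = of_int (family_invariant_numerator (int n))"
proof -
  define c :: rat where "c = 1 / of_nat n"
  have nc: "of_nat n * c = 1" using assms by (simp add: c_def)
  have Jc: "octic_invariant (torsion_family c) = 5720 * c ^ 3 - 194151672 * c ^ 2 + 2194642230144 * c - 8261922220744192"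
    by (simp add: octic_invariant_def torsion_family_def coeff_pCons numeral_eq_Suc) (simp add: algebra_simps power2_eq_square power3_eq_cube)
  have "of_nat n ^ 3 * octic_invariant (torsion_family c) = 5720 * (of_nat n * c) ^ 3 - 194151672 * (of_nat n * c) ^ 2 * of_nat n
      + 2194642230144 * (of_nat n * c) * of_nat n ^ 2 - 8261922220744192 * of_nat n ^ 3"
    unfolding Jc by (simp add: algebra_simps power2_eq_square power3_eq_cube)
  then show ?thesis unfolding nc by (simp add: c_def family_invariant_numerator_def)
qed

text \<open>At \<open>p\<close> the left side has valuation -3, while the invariant for
  \<open>q\<close> is a unit, so the right side has a multiple of 4. With
  \<open>\<rho> = n / d\<close> and denominators cleared, \<open>4 m(d)\<close> faces
  \<open>4 m(n) + 3\<close>.\<close>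

lemma invariant_family_not_fourth_power:
  fixes p q :: nat
  assumes p: "Factorial_Ring.prime p" "5720 < p" and q: "0 < q" "q < p"
    and small: "family_invariant_numerator (int q) \<noteq> 0" "\<bar>family_invariant_numerator (int q)\<bar> < int p"
  shows "octic_invariant (torsion_family (1 / of_nat p)) \<noteq> \<rho> ^ 4 * octic_invariant (torsion_family (1 / of_nat q))"
proof
  assume eq: "octic_invariant (torsion_family (1 / of_nat p)) = \<rho> ^ 4 * octic_invariant (torsion_family (1 / of_nat q))"
  have p0: "p > 0" using p by simp
  have prime: "prime_elem (int p)" using p by simp
  obtain n d where \<rho>: "\<rho> = of_int n / of_int d" and d: "d \<noteq> 0" using Rat_cases[of \<rho>]
    by (metis Fract_of_int_quotient less_irrefl)
  have ndvd: "\<not> int p dvd x" if "x \<noteq> 0" "\<bar>x\<bar> < int p" for x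
    using that dvd_imp_le_int[of x "int p"] by auto
  have "\<not> int p dvd family_invariant_numerator (int p)"
  proof
    assume "int p dvd family_invariant_numerator (int p)"
    moreover have "family_invariant_numerator (int p) = 5720 + int p * (- 194151672 + 2194642230144 * int p - 8261922220744192 * int p ^ 2)"
      by (simp add: family_invariant_numerator_def algebra_simps power2_eq_square power3_eq_cube)
    ultimately have "int p dvd 5720" by (metis dvd_add_left_iff dvd_triv_left)
    then show False using ndvd[of 5720] p by simp
  qed
  have "of_int (family_invariant_numerator (int p) * int q ^ 3 * d ^ 4) = (of_int (n ^ 4 * int p ^ 3 * family_invariant_numerator (int q)) :: rat)"
  proof -
    have "of_int d * \<rho> = of_int n" using d by (simp add: \<rho>)
    then have n4: "(of_int n :: rat) ^ 4 = of_int d ^ 4 * \<rho> ^ 4" by (metis power_mult_distrib)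
    have "of_int (family_invariant_numerator (int p)) * of_nat q ^ 3 * of_int d ^ 4
        = of_nat p ^ 3 * (\<rho> ^ 4 * octic_invariant (torsion_family (1 / of_nat q))) * of_nat q ^ 3 * of_int d ^ 4"
      unfolding invariant_family[OF p0, symmetric] eq ..
    also have "\<dots> = (of_int d ^ 4 * \<rho> ^ 4) * of_nat p ^ 3 * (of_nat q ^ 3 * octic_invariant (torsion_family (1 / of_nat q)))"
      by (simp only: mult_ac)
    also have "\<dots> = of_int n ^ 4 * of_nat p ^ 3 * of_int (family_invariant_numerator (int q))"
      unfolding invariant_family[OF q(1)] n4 ..
    finally show ?thesis by simp
  qed
  then have e: "family_invariant_numerator (int p) * int q ^ 3 * d ^ 4 = n ^ 4 * int p ^ 3 * family_invariant_numerator (int q)"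
    by (simp only: of_int_eq_iff)
  let ?m = "multiplicity (int p)"
  have nz: "family_invariant_numerator (int p) \<noteq> 0" using \<open>\<not> int p dvd family_invariant_numerator (int p)\<close> by auto
  have "n \<noteq> 0"
  proof
    assume "n = 0"
    then show False using e nz q d by simp
  qed
  have "?m (family_invariant_numerator (int p) * int q ^ 3 * d ^ 4) = 4 * ?m d"
    using prime nz q d \<open>\<not> int p dvd family_invariant_numerator (int p)\<close> ndvd[of "int q"]
    by (simp add: prime_elem_multiplicity_mult_distrib prime_elem_multiplicity_power_distrib not_dvd_imp_multiplicity_0)
  moreover have "?m (n ^ 4 * int p ^ 3 * family_invariant_numerator (int q)) = 4 * ?m n + 3"
    using prime \<open>n \<noteq> 0\<close> p0 small ndvd[of "family_invariant_numerator (int q)"] p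
    by (simp add: prime_elem_multiplicity_mult_distrib prime_elem_multiplicity_power_distrib not_dvd_imp_multiplicity_0)
  ultimately have "4 * ?m d = 4 * ?m n + 3" using e by simp
  then show False by presburger
qed

text \<open>Modulo \<open>p\<close> only 5720 survives, which is positive and smaller than
  \<open>p\<close>.\<close>

lemma family_invariant_numerator_nonzero:
  assumes "Factorial_Ring.prime p" "5720 < p" shows "family_invariant_numerator (int p) \<noteq> 0"
proof
  assume "family_invariant_numerator (int p) = 0"
  then have "5720 = int p * (194151672 - 2194642230144 * int p + 8261922220744192 * int p ^ 2)"
    by (simp add: family_invariant_numerator_def algebra_simps power2_eq_square power3_eq_cube)
  then have "int p dvd 5720" by (metis dvd_triv_left)
  then show False using assms dvd_imp_le_int[of 5720 "int p"] by simp
qed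

theorem theorem4p1:
  shows "infinite ({f :: rat poly. hyperelliptic_poly 3 f \<and>
           (\<exists>A \<in> carrier (jacobian_rational_points f).
              group.ord (jacobian_rational_points f) A = 13)}
         // {(f, h). curve_isomorphic f h})"
    (is "infinite (?S // ?R)")
proof
  assume fin: "finite (?S // ?R)"
  define g :: "nat \<Rightarrow> rat poly" where "g p = torsion_family (1 / of_nat p)" for p
  define cl where "cl p = ?R `` {g p}" for p
  let ?P = "{p :: nat. Factorial_Ring.prime p \<and> 5720 < p}"
  have sf: "squarefree (g p)" if "p > 0" for p
    unfolding g_def using torsion_family_no_double_root[OF that refl] degree_torsion_family[of "1 / of_nat p :: rat"]
    by (intro squarefree_base_change) auto
  have S: "g p \<in> ?S" if "p > 0" for p
    using sf[OF that] torsion_family_torsion_point[OF that refl] by (simp add: hyperelliptic_poly_def g_def degree_torsion_family)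
  have "infinite ?P"
  proof
    assume "finite ?P"
    then have "finite (?P \<union> {..5720})" by simp
    moreover have "{p :: nat. Factorial_Ring.prime p} \<subseteq> ?P \<union> {..5720}" by auto
    ultimately show False using primes_infinite finite_subset by blast
  qed
  moreover have "cl ` ?P \<subseteq> ?S // ?R"
  proof (rule image_subsetI)
    fix p assume "p \<in> ?P"
    then have "g p \<in> ?S" by (intro S) simp
    then show "cl p \<in> ?S // ?R" unfolding cl_def by (rule quotientI)
  qed
  then have "finite (cl ` ?P)" using fin finite_subset by blast
  \<comment> \<open>One class recurs for infinitely many primes, which leaves room to choose
    \<open>p\<close> beyond both \<open>q\<close> and the numerator of its invariant, so that
    \<open>p\<close> divides neither.\<close>
  ultimately obtain q where q: "q \<in> ?P" and inf: "infinite {p \<in> ?P. cl p = cl q}"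
    using pigeonhole_infinite by blast
  obtain p where p: "p \<in> ?P" "cl p = cl q" "p > q + nat \<bar>family_invariant_numerator (int q)\<bar>"
    using inf unfolding infinite_nat_iff_unbounded by blast
  \<comment> \<open>Reflexivity puts \<open>g p\<close> in its own class, so equality of the two
    classes yields an isomorphism between the curves for \<open>q\<close> and
    \<open>p\<close>.\<close>
  have "curve_isomorphic (g p) (g p)"
    unfolding curve_isomorphic_def by (intro exI[of _ id]) simp
  then have "g p \<in> cl p" by (simp add: cl_def)
  then have "g p \<in> cl q" unfolding p(2) .
  then have "curve_isomorphic (g q) (g p)" by (simp add: cl_def)
  then obtain \<rho> where "octic_invariant (g p) = \<rho> ^ 4 * octic_invariant (g q)"
    using curve_isomorphic_invariant[of "g q" "g p"] sf[of p] p(1) by (auto simp: g_def degree_torsion_family)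
  moreover have "octic_invariant (g p) \<noteq> \<rho> ^ 4 * octic_invariant (g q)"
    unfolding g_def using p q family_invariant_numerator_nonzero[of q] by (intro invariant_family_not_fourth_power) auto
  ultimately show False by blast
qed

end
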